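(* Let $u(x,t)$ be a smooth solution of the normalized Gauss curvature flow $$\frac{\partial u}{\partial t}=u-\frac1{\det(\bar g^{ik}(\bar\nabla_k\bar\nabla_ju+u\,\bar g_{kj}))}\quad\text{on }\mathbb{S}^n$$ with $\bar\nabla^2u+u\bar g>0$, where $u(\cdot,t)$ is the support function of a convex body $\Omega_t\subset\mathbb{R}^{n+1}$ and $V(\Omega_0)=V(B(1))$. Then $t\mapsto\mathcal{E}(\Omega_t)$ is monotone non-increasing. Moreover, for all $t_1\le t_0$ in the time interval of existence, $$\mathcal{E}(\Omega_{t_0})-\mathcal{E}(\Omega_{t_1})\le\int_{t_1}^{t_0}\bigl(\mathcal{E}(\Omega_t)-\mathcal{E}_C(\Omega_t)\bigr)\,dt\le 0 .$$
   Context: $V$ is Lebesgue measure, $B(1)$ the unit ball of $\mathbb{R}^{n+1}$; $\bar g,\bar\nabla$ are the standard metric and covariant derivative on $\mathbb{S}^n$, $d\theta$ the surface measure and $\omega_n$ the area of $\mathbb{S}^n$. For a compact convex body $\Omega$ with nonempty interior and $z_0\in\Omega$, $u_{z_0}(x)=\max_{z\in\Omega}\langle x,z-z_0\rangle$, and $$\mathcal{E}(\Omega)=\sup_{u_{z_0}>0}\frac1{\omega_n}\int_{\mathbb{S}^n}\log u_{z_0}\,d\theta,$$ the supremum being over $z_0\in\Omega$ with $u_{z_0}>0$ on $\mathbb{S}^n$. For $\Omega$ with smooth boundary of positive Gauss curvature $K$ (viewed also as a function on $\mathbb{S}^n$ via the inverse Gauss map), $$\mathcal{E}_C(\Omega)=\frac1{\omega_n}\int_{\partial\Omega}K\log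 K\,d\sigma=\frac1{\omega_n}\int_{\mathbb{S}^n}\log K\,d\theta .$$ In the flow equation, $1/\det(\bar\nabla^2u+u\bar g)=K$. The normalization $V(\Omega_0)=V(B(1))$ implies $V(\Omega_t)=V(B(1))$ for all $t$. *)

theory Defs
  imports "HOL-Analysis.Analysis"
begin

section \<open>Smooth functions\<close>

primrec C_k_on :: "nat \<Rightarrow> 'a::real_normed_vector set \<Rightarrow> ('a \<Rightarrow> 'b::real_normed_vector) \<Rightarrow> bool" where
  "C_k_on 0 U f \<longleftrightarrow> continuous_on U f"
| "C_k_on (Suc k) U f \<longleftrightarrow>
     (\<forall>x\<in>U. f differentiable (at x)) \<and>
     (\<forall>v. C_k_on k U (\<lambda>x. frechet_derivative f (at x) v))"

text \<open>Smoothness on an arbitrary subset of a normed space: local extendability to a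
  \<open>C\<^sup>\<infinity>\<close> function on an ambient open set.  On an embedded submanifold, with or without boundary
  (here the sphere times an interval), this is the usual notion; at an endpoint of a closed or
  half-open time interval it means smoothness up to that endpoint.\<close>

definition smooth_on_set :: "'a::real_normed_vector set \<Rightarrow> ('a \<Rightarrow> 'b::real_normed_vector) \<Rightarrow> bool" where
  "smooth_on_set S f \<longleftrightarrow>
     (\<forall>p\<in>S. \<exists>U g. open U \<and> p \<in> U \<and> (\<forall>k. C_k_on k U g) \<and> (\<forall>y\<in>U \<inter> S. g y = f y))"


section \<open>The standard metric, connection and measure of the unit sphere\<close>

text \<open>With \<open>CARD('n) = n + 1\<close>, the sphere \<open>S\<^sup>n\<close> is \<^term>\<open>sphere (0::real^'n) 1\<close>.  At a point
  \<open>x\<close> of it the tangent space is the orthogonal complement of \<open>x\<close>, and the standard metric is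
  the restriction of the inner product.\<close>

definition tan_proj :: "'a::real_inner \<Rightarrow> 'a \<Rightarrow> 'a" where
  "tan_proj x v = v - (x \<bullet> v) *\<^sub>R x"

text \<open>A function on the sphere is differentiated through its radially constant extension
  \<open>y \<mapsto> f (sgn y)\<close>, where \<open>sgn y = y / norm y\<close>; the Euclidean gradient of that extension at a
  point of the sphere is tangential and is the gradient for the induced metric.\<close>

definition sphere_grad :: "('a::real_inner \<Rightarrow> real) \<Rightarrow> 'a \<Rightarrow> 'a" where
  "sphere_grad f x = (THE D. GDERIV (\<lambda>y. f (sgn y)) x :> D)"

text \<open>The Levi-Civita connection of the induced metric: the tangential part of the ambient
  derivative of a tangent field \<open>X\<close> in the tangent direction \<open>v\<close>.\<close>

definition sphere_cov :: "('a::real_inner \<Rightarrow> 'a) \<Rightarrow> 'a \<Rightarrow> 'a \<Rightarrow> 'a" where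
  "sphere_cov X x v = tan_proj x (frechet_derivative (\<lambda>y. X (sgn y)) (at x) v)"

text \<open>The endomorphism \<open>g\<^sup>i\<^sup>k (\<nabla>\<^sub>k \<nabla>\<^sub>j f + f g\<^sub>k\<^sub>j)\<close> of the tangent space at \<open>x\<close>.\<close>

definition hess_plus :: "('a::real_inner \<Rightarrow> real) \<Rightarrow> 'a \<Rightarrow> 'a \<Rightarrow> 'a" where
  "hess_plus f x v = sphere_cov (sphere_grad f) x v + f x *\<^sub>R v"

text \<open>Determinant of an endomorphism \<open>A\<close> of the hyperplane orthogonal to the unit vector \<open>x\<close>:
  \<open>A\<close> is extended by the identity on the line through \<open>x\<close>, which adds a diagonal block \<open>1\<close>.
  Only the values of \<open>A\<close> on that hyperplane matter.\<close>

definition tan_det :: "real^'n \<Rightarrow> (real^'n \<Rightarrow> real^'n) \<Rightarrow> real" where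
  "tan_det x A = det (matrix (\<lambda>v. A (tan_proj x v) + (x \<bullet> v) *\<^sub>R x))"

text \<open>Surface measure, normalised as in polar coordinates: the area of a Borel set \<open>A\<close> of unit
  vectors is \<open>n + 1\<close> times the volume of the cone \<open>{r x | 0 < r \<le> 1, x \<in> A}\<close>.\<close>

definition sphere_measure :: "(real^'n) measure" where
  "sphere_measure =
     density
       (distr (restrict_space lborel (cball 0 1 - {0})) (restrict_space borel (sphere 0 1)) sgn)
       (\<lambda>_. ennreal (real CARD('n)))"

definition sphere_mean :: "(real^'n \<Rightarrow> real) \<Rightarrow> real" where
  "sphere_mean f =
     (1 / measure sphere_measure (sphere (0::real^'n) 1)) * (LINT x|sphere_measure. f x)"


section \<open>Convex bodies and entropies\<close>

definition convex_body :: "'a::euclidean_space set \<Rightarrow> bool" where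
  "convex_body \<Omega> \<longleftrightarrow> compact \<Omega> \<and> convex \<Omega> \<and> interior \<Omega> \<noteq> {}"

definition support_fun :: "'a::real_inner set \<Rightarrow> 'a \<Rightarrow> 'a \<Rightarrow> real" where
  "support_fun \<Omega> z0 x = (SUP z\<in>\<Omega>. x \<bullet> (z - z0))"

definition entropy :: "(real^'n) set \<Rightarrow> real" where
  "entropy \<Omega> =
     (SUP z0\<in>{z0\<in>\<Omega>. \<forall>x\<in>sphere 0 1. support_fun \<Omega> z0 x > 0}.
        sphere_mean (\<lambda>x. ln (support_fun \<Omega> z0 x)))"

definition gauss_map :: "'a::real_inner set \<Rightarrow> 'a \<Rightarrow> 'a" where
  "gauss_map \<Omega> p = (THE \<nu>. norm \<nu> = 1 \<and> (\<forall>z\<in>\<Omega>. \<nu> \<bullet> z \<le> \<nu> \<bullet> p))"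

text \<open>Determinant of the differential of the Gauss map (the Weingarten map) on the tangent space
  at \<open>p\<close>, the hyperplane orthogonal to the normal.  A derivative at \<open>p\<close> within the boundary
  hypersurface is determined only on that tangent space, which is all that enters here.\<close>

definition gauss_curvature :: "(real^'n) set \<Rightarrow> real^'n \<Rightarrow> real" where
  "gauss_curvature \<Omega> p =
     tan_det (gauss_map \<Omega> p) (frechet_derivative (gauss_map \<Omega>) (at p within frontier \<Omega>))"

definition curvature_entropy :: "(real^'n) set \<Rightarrow> real" where
  "curvature_entropy \<Omega> =
     sphere_mean (\<lambda>x. ln (gauss_curvature \<Omega> (inv_into (frontier \<Omega>) (gauss_map \<Omega>) x)))"


section \<open>The normalised Gauss curvature flow\<close>

definition normalized_gauss_flow :: "real set \<Rightarrow> (real^'n \<Rightarrow> real \<Rightarrow> real) \<Rightarrow> bool" where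
  "normalized_gauss_flow I u \<longleftrightarrow>
     smooth_on_set (sphere 0 1 \<times> I) (\<lambda>(x, t). u x t) \<and>
     (\<forall>t\<in>I. \<forall>x\<in>sphere 0 1. \<forall>v. x \<bullet> v = 0 \<longrightarrow> v \<noteq> 0 \<longrightarrow> v \<bullet> hess_plus (\<lambda>y. u y t) x v > 0) \<and>
     (\<forall>t\<in>I. \<forall>x\<in>sphere 0 1.
        ((\<lambda>s. u x s) has_real_derivative
          (u x t - 1 / tan_det x (hess_plus (\<lambda>y. u y t) x))) (at t within I))"

end

theory Submission
  imports Defs
begin

text \<open>Fix an interior point \<open>z0\<close> of the body at the final time \<open>b\<close> and put
  \<open>v = u - exp (t - b) * (x \<bullet> z0)\<close>.  This is again a solution of the flow, and it is positive on
  \<open>t \<le> b\<close> because \<open>exp (- t) * v\<close> decreases.  As \<open>v\<^sub>t = v - K\<close> and \<open>1 - y \<le> - ln y\<close>, the mean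
  of \<open>ln v\<close> grows at a rate of at most the mean of \<open>ln v - ln K\<close>, which is at most the entropy minus
  the curvature entropy.  Integrating and taking the supremum over \<open>z0\<close> gives the first inequality,
  so no entropy point has to be selected.  The sign of the integrand is Jensen's inequality for
  \<open>ln (v / K)\<close>, since the mean of \<open>v / K\<close> is the volume of the body divided by that of the ball.

  Both facts on volumes come from the parametrisation \<open>P(x, t) = u x + \<nabla> u\<close> of the boundary by its
  normal.  The Jacobian of \<open>r x \<mapsto> r P(x, t)\<close> is \<open>u / K\<close>, and that of \<open>r x \<mapsto> r P(x, - ln r)\<close> is \<open>1\<close>.
  The second map sends an annulus onto the region between two of the nested bodies
  \<open>exp (- t) \<Omega>\<^sub>t\<close>, so \<open>exp (- (n + 1) t) (V(\<Omega>\<^sub>t) - V(B(1)))\<close> is constant.\<close>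

section \<open>Change of variables over an arbitrary finite index type\<close>

text \<open>Restrictions of linear functions to the sphere are annihilated by f |-> Hess f + f g, so
  subtracting one from \<open>u\<close> leaves \<open>K\<close> unchanged; the linear part f_t = f
  of the flow makes its coefficient grow like \<open>exp t\<close>, and the factor
  \<open>exp (- b)\<close> makes the moving point equal to \<open>z0\<close> at time
  \<open>b\<close>. The point has to be prescribed at the final time: the bodies
  \<open>exp (- t)\<close> times \<Omega>_t shrink, so a point that is interior at the start may be
  left outside, whereas one that is interior at the end was so all along. The usual proof that
  volume is constant differentiates the integral of u / K in time and integrates by parts on the
  sphere. A volume preserving map whose radial variable is time reduces this to the change of
  variables formula, which asks only for first derivatives of the parametrisation. The entropy is a
  supremum over points, and nothing direct is known about its dependence on time. Its integrability
  comes from monotonicity, which is therefore established by itself before the integral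
  inequality.\<close>

text \<open>The library states the change of variables formula for index types that are well-ordered.
  Any finite type has a copy of this kind.\<close>

typedef 'a ordered_copy = "UNIV :: 'a set" ..

instance ordered_copy :: (finite) finite
proof
  have "finite (range (Abs_ordered_copy :: 'a \<Rightarrow> _))"
    by simp
  also have "range Abs_ordered_copy = (UNIV :: 'a ordered_copy set)"
    by (auto intro: Rep_ordered_copy_inverse[symmetric])
  finally show "finite (UNIV :: 'a ordered_copy set)" .
qed

definition copy_rank :: "'a::finite ordered_copy \<Rightarrow> nat" where
  "copy_rank x = (SOME f::'a \<Rightarrow> nat. inj f) (Rep_ordered_copy x)"

lemma inj_copy_rank: "inj (copy_rank :: 'a::finite ordered_copy \<Rightarrow> nat)"
proof -
  have "\<exists>f::'a \<Rightarrow> nat. inj f"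
    using finite_imp_inj_to_nat_seg[of "UNIV :: 'a set"] by auto
  then have "inj (SOME f::'a \<Rightarrow> nat. inj f)" by (rule someI_ex)
  then show ?thesis
    unfolding copy_rank_def by (rule inj_compose[unfolded o_def]) (simp add: inj_def Rep_ordered_copy_inject)
qed

instantiation ordered_copy :: (finite) linorder
begin
definition "x \<le> y \<longleftrightarrow> copy_rank x \<le> copy_rank y" for x y :: "'a ordered_copy"
definition "x < y \<longleftrightarrow> copy_rank x < copy_rank y" for x y :: "'a ordered_copy"
instance
proof
  fix x y z :: "'a ordered_copy"
  show "x < y \<longleftrightarrow> x \<le> y \<and> \<not> y \<le> x"
    unfolding less_eq_ordered_copy_def less_ordered_copy_def by linarith
  show "x \<le> x"
    unfolding less_eq_ordered_copy_def by simp
  show "x \<le> y \<or> y \<le> x"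
    unfolding less_eq_ordered_copy_def by linarith
  show "x \<le> z" if "x \<le> y" "y \<le> z"
    using that unfolding less_eq_ordered_copy_def by linarith
  show "x = y" if "x \<le> y" "y \<le> x"
    using that injD[OF inj_copy_rank] unfolding less_eq_ordered_copy_def by (meson le_antisym)
qed
end

instance ordered_copy :: (finite) wellorder
proof
  fix P :: "'a ordered_copy \<Rightarrow> bool" and a
  assume *: "\<And>x. (\<And>y. y < x \<Longrightarrow> P y) \<Longrightarrow> P x"
  show "P a"
    by (rule measure_induct_rule[of copy_rank]) (use * in \<open>simp add: less_ordered_copy_def\<close>)
qed

lemma bij_Rep_ordered_copy: "bij Rep_ordered_copy"
proof (rule bijI')
  show "\<exists>x. y = Rep_ordered_copy x" for y :: 'a
    using Abs_ordered_copy_inverse[of y] by (metis UNIV_I)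
qed (simp add: Rep_ordered_copy_inject)

text \<open>Conjugation by \<open>f\<close> is a bijection between the permutations of the two index
  types and preserves signs, so the two Leibniz expansions agree term by term.\<close>

lemma det_reindex:
  fixes A :: "'a::comm_ring_1^'n^'n" and f :: "'m::finite \<Rightarrow> 'n"
  assumes f: "bij f"
  shows "det (\<chi> i j. A $ f i $ f j) = det A"
proof -
  let ?g = "map_permutation UNIV f"
  have g: "?g p = f \<circ> p \<circ> inv f" for p
    using f by (auto simp: map_permutation_def bij_def)
  have "det A = (\<Sum>q | q permutes UNIV. of_int (sign q) * (\<Prod>i\<in>UNIV. A $ i $ q i))"
    by (simp add: det_def)
  also have "\<dots> = (\<Sum>p | p permutes UNIV. of_int (sign (?g p)) * (\<Prod>i\<in>UNIV. A $ i $ ?g p i))"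
  proof (rule sum.reindex_bij_witness[where i = ?g and j = "\<lambda>q. inv f \<circ> q \<circ> f"])
    fix q :: "'n \<Rightarrow> 'n" assume "q \<in> {q. q permutes UNIV}"
    then have q: "bij q" by (simp add: permutes_bij)
    show "?g (inv f \<circ> q \<circ> f) = q"
      using f by (auto simp: g fun_eq_iff bij_def surj_f_inv_f)
    then show "of_int (sign (?g (inv f \<circ> q \<circ> f))) * (\<Prod>i\<in>UNIV. A $ i $ ?g (inv f \<circ> q \<circ> f) i)
        = of_int (sign q) * (\<Prod>i\<in>UNIV. A $ i $ q i)"
      by simp
    show "inv f \<circ> q \<circ> f \<in> {p. p permutes UNIV}"
      using f q by (auto intro!: bij_imp_permutes bij_comp bij_imp_bij_inv)
  next
    fix p :: "'m \<Rightarrow> 'm" assume "p \<in> {p. p permutes UNIV}"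
    then have p: "p permutes UNIV" by simp
    show "inv f \<circ> ?g p \<circ> f = p"
      using f by (auto simp: g fun_eq_iff bij_def)
    show "?g p \<in> {q. q permutes UNIV}"
      using map_permutation_permutes[OF _ p, of f UNIV] f by simp
  qed
  also have "\<dots> = (\<Sum>p | p permutes UNIV. of_int (sign p) * (\<Prod>i\<in>UNIV. A $ f i $ f (p i)))"
  proof (rule sum.cong)
    fix p :: "'m \<Rightarrow> 'm" assume "p \<in> {p. p permutes UNIV}"
    then have p: "p permutes UNIV" by simp
    have "sign (?g p) = sign p"
      using f by (intro sign_map_permutation p) (auto simp: bij_def)
    moreover have "(\<Prod>i\<in>UNIV. A $ i $ ?g p i) = (\<Prod>i\<in>UNIV. A $ f i $ f (p i))"
      using f by (intro prod.reindex_bij_witness[where i = f and j = "inv f"])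
        (auto simp: g bij_def surj_f_inv_f)
    ultimately show "of_int (sign (?g p)) * (\<Prod>i\<in>UNIV. A $ i $ ?g p i)
      = of_int (sign p) * (\<Prod>i\<in>UNIV. A $ f i $ f (p i))" by simp
  qed simp
  finally show ?thesis by (simp add: det_def)
qed

text \<open>Lebesgue measure is determined by its values on boxes, and relabelling coordinates turns
  a box into a box with the same side lengths in another order.\<close>

lemma lborel_reindex:
  fixes f :: "'m::finite \<Rightarrow> 'n::finite"
  assumes f: "bij f"
  shows "distr lborel borel (\<lambda>v::real^'n. (\<chi> i. v $ f i) :: real^'m) = lborel"
proof (rule lborel_eqI[symmetric])
  let ?\<phi> = "\<lambda>v::real^'n. (\<chi> i. v $ f i) :: real^'m"
  have "continuous_on UNIV ?\<phi>"
    by (intro continuous_intros)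
  then have m[measurable]: "?\<phi> \<in> borel_measurable borel"
    by (rule borel_measurable_continuous_onI)
  fix l u :: "real^'m" assume le: "\<And>b. b \<in> Basis \<Longrightarrow> l \<bullet> b \<le> u \<bullet> b"
  have le': "l $ i \<le> u $ i" for i
    using le[of "axis i 1"] by (simp add: axis_in_Basis_iff inner_axis)
  let ?l = "(\<chi> j. l $ inv f j) :: real^'n" and ?u = "(\<chi> j. u $ inv f j) :: real^'n"
  have "?\<phi> -` box l u = box ?l ?u"
    using f by (auto simp: mem_box_cart bij_def surj_f_inv_f) (metis surj_f_inv_f inv_f_f)+
  then have "emeasure (distr lborel borel ?\<phi>) (box l u) = emeasure lborel (box ?l ?u)"
    by (simp add: emeasure_distr)
  also have "\<dots> = (\<Prod>b\<in>Basis. (?u - ?l) \<bullet> b)"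
    using le' by (subst emeasure_lborel_box) (auto simp: Basis_vec_def inner_axis)
  also have "(\<Prod>b\<in>Basis. (?u - ?l) \<bullet> b) = (\<Prod>j\<in>UNIV. (?u - ?l) $ j)"
    by (intro prod.reindex_bij_witness[where i = "\<lambda>j. axis j 1" and j = "\<lambda>b. SOME j. b = axis j 1"])
      (auto simp: Basis_vec_def inner_axis axis_eq_axis)
  also have "\<dots> = (\<Prod>i\<in>UNIV. (u - l) $ i)"
    using f by (intro prod.reindex_bij_witness[where i = f and j = "inv f"])
        (auto simp: bij_def surj_f_inv_f)
  also have "\<dots> = (\<Prod>b\<in>Basis. (u - l) \<bullet> b)"
    by (intro prod.reindex_bij_witness[where j = "\<lambda>j. axis j 1" and i = "\<lambda>b. SOME j. b = axis j 1"])
      (auto simp: Basis_vec_def inner_axis axis_eq_axis)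
  finally show "emeasure (distr lborel borel ?\<phi>) (box l u) = (\<Prod>b\<in>Basis. (u - l) \<bullet> b)" .
qed simp

text \<open>Conjugating \<open>f\<close> by the relabelling \<open>\<phi>\<close> changes neither
  volumes nor Jacobians. The function \<open>J\<close> stands in for the absolute determinant, so
  that measurability and integrability are asked of an explicit formula rather than of a
  derivative.\<close>

lemma measure_injective_image:
  fixes f :: "real^'n \<Rightarrow> real^'n"
  assumes S: "S \<in> sets borel" and fS: "f ` S \<in> sets borel"
    and der: "\<And>x. x \<in> S \<Longrightarrow> (f has_derivative f' x) (at x)"
    and inj: "inj_on f S"
    and J: "J \<in> borel_measurable borel" "set_integrable lborel S J"
      "\<And>x. x \<in> S \<Longrightarrow> \<bar>det (matrix (f' x))\<bar> = J x"
  shows "measure lborel (f ` S) = (LINT x:S|lborel. J x)"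
proof -
  let ?R = "Rep_ordered_copy :: 'n ordered_copy \<Rightarrow> 'n"
  define \<phi> where "\<phi> = (\<lambda>v::real^'n. (\<chi> i. v $ ?R i) :: real^'n ordered_copy)"
  define \<psi> where "\<psi> = (\<lambda>w::real^'n ordered_copy. (\<chi> i. w $ Abs_ordered_copy i) :: real^'n)"
  have \<psi>\<phi>[simp]: "\<psi> (\<phi> v) = v" for v
    by (simp add: \<phi>_def \<psi>_def vec_eq_iff Abs_ordered_copy_inverse)
  have \<phi>\<psi>[simp]: "\<phi> (\<psi> w) = w" for w
    by (simp add: \<phi>_def \<psi>_def vec_eq_iff Rep_ordered_copy_inverse)
  have lin: "linear \<phi>" "linear \<psi>"
    by (auto simp: \<phi>_def \<psi>_def linear_iff vec_eq_iff)
  have [measurable]: "\<phi> \<in> borel_measurable borel" "\<psi> \<in> borel_measurable borel"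
    using lin by (auto intro!: borel_measurable_continuous_onI linear_continuous_on
        simp: linear_conv_bounded_linear)
  have image_\<phi>: "\<phi> ` T = \<psi> -` T" for T
    by (force simp: image_iff)
  have image_sets: "\<phi> ` T \<in> sets borel" if "T \<in> sets borel" for T
    using measurable_sets[of \<psi> borel borel T] that by (simp add: image_\<phi>)
  have distr: "distr lborel borel \<phi> = lborel"
    unfolding \<phi>_def by (rule lborel_reindex[OF bij_Rep_ordered_copy])
  have meas: "measure lborel (\<phi> ` T) = measure lborel T" if "T \<in> sets borel" for T
  proof -
    have "measure lborel (\<phi> ` T) = measure (distr lborel borel \<phi>) (\<phi> ` T)"
      by (simp add: distr)
    also have "\<dots> = measure lborel (\<phi> -` \<phi> ` T)"
      using image_sets[OF that] by (simp add: measure_distr)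
    also have "\<phi> -` \<phi> ` T = T"
      by (force simp: image_\<phi>)
    finally show ?thesis .
  qed
  let ?g = "\<phi> \<circ> f \<circ> \<psi>" and ?g' = "\<lambda>x. \<phi> \<circ> f' (\<psi> x) \<circ> \<psi>"
  have der_g: "(?g has_derivative ?g' x) (at x within \<phi> ` S)" if "x \<in> \<phi> ` S" for x
  proof -
    have "\<psi> x \<in> S" using that by auto
    then have "(?g has_derivative ?g' x) (at x)"
      using lin der by (intro diff_chain_at linear_imp_has_derivative) auto
    then show ?thesis by (rule has_derivative_at_withinI)
  qed
  have inj_g: "inj_on ?g (\<phi> ` S)"
    using inj by (auto simp: inj_on_def) (metis \<psi>\<phi>)
  have det_g: "\<bar>det (matrix (?g' x))\<bar> = J (\<psi> x)" if x: "x \<in> \<phi> ` S" for x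
  proof -
    have "\<psi> x \<in> S" using x by auto
    have "matrix (?g' x) = (\<chi> i j. matrix (f' (\<psi> x)) $ ?R i $ ?R j)"
    proof -
      have "\<psi> (axis j 1) = axis (?R j) 1" for j
        by (auto simp: \<psi>_def vec_eq_iff axis_def Abs_ordered_copy_inverse Rep_ordered_copy_inverse)
      then show ?thesis by (simp add: matrix_def \<phi>_def)
    qed
    then show ?thesis
      using det_reindex[OF bij_Rep_ordered_copy, of "matrix (f' (\<psi> x))"] J(3)[OF \<open>\<psi> x \<in> S\<close>]
      by simp
  qed
  have int_J: "set_integrable lborel (\<phi> ` S) (J \<circ> \<psi>)"
    and eq_J: "(LINT x:\<phi> ` S|lborel. J (\<psi> x)) = (LINT x:S|lborel. J x)"
  proof -
    have *: "indicator (\<phi> ` S) (\<phi> x) = indicat_real S x" for x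
      by (auto simp: indicator_def image_\<phi>)
    have [measurable]: "\<phi> ` S \<in> sets borel" by (rule image_sets[OF S])
    note J(1)[measurable] S[measurable]
    have "integrable (distr lborel borel \<phi>) (\<lambda>x. indicator (\<phi> ` S) x *\<^sub>R (J \<circ> \<psi>) x)"
      using J(2) by (subst integrable_distr_eq) (auto simp: set_integrable_def * )
    then show "set_integrable lborel (\<phi> ` S) (J \<circ> \<psi>)"
      by (simp add: distr set_integrable_def)
    have "(\<integral>x. indicator (\<phi> ` S) x *\<^sub>R J (\<psi> x) \<partial>distr lborel borel \<phi>)
       = (\<integral>x. indicator S x *\<^sub>R J x \<partial>lborel)"
      by (subst integral_distr) (auto simp: * )
    then show "(LINT x:\<phi> ` S|lborel. J (\<psi> x)) = (LINT x:S|lborel. J x)"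
      by (simp add: distr set_lebesgue_integral_def)
  qed
  have HK: "((\<lambda>x. J (\<psi> x)) has_integral (LINT x:S|lborel. J x)) (\<phi> ` S)"
    using eq_J set_borel_integral_eq_integral[OF int_J]
    by (simp add: o_def has_integral_integrable_integral)
  then have HK': "((\<lambda>x. \<bar>det (matrix (?g' x))\<bar>) has_integral (LINT x:S|lborel. J x)) (\<phi> ` S)"
    by (rule has_integral_eq[rotated]) (simp add: det_g)
  have "measure lebesgue (?g ` \<phi> ` S) = integral (\<phi> ` S) (\<lambda>x. \<bar>det (matrix (?g' x))\<bar>)"
    using image_sets[OF S] HK' by (intro measure_differentiable_image_eq der_g inj_g)
      (auto simp: has_integral_integrable_integral)
  also have "\<dots> = (LINT x:S|lborel. J x)"
    using HK' by (rule integral_unique)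
  also have "?g ` \<phi> ` S = \<phi> ` (f ` S)"
    by (simp add: image_comp o_def)
  also have "measure lebesgue (\<phi> ` (f ` S)) = measure lborel (f ` S)"
    using meas[OF fS] image_sets[OF fS] by (simp add: measure_completion)
  finally show ?thesis .
qed

section \<open>Determinants on a hyperplane\<close>

lemma linear_tan_proj: "linear (tan_proj x)"
  by (rule linearI) (simp_all add: tan_proj_def algebra_simps inner_add_right)

lemma inner_tan_proj [simp]: "norm x = 1 \<Longrightarrow> x \<bullet> tan_proj x v = 0"
  by (simp add: tan_proj_def inner_diff_right dot_square_norm)

lemma tan_proj_self [simp]: "norm x = 1 \<Longrightarrow> tan_proj x x = 0"
  by (simp add: tan_proj_def dot_square_norm)

lemma tan_proj_tangent: "x \<bullet> v = 0 \<Longrightarrow> tan_proj x v = v"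
  by (simp add: tan_proj_def)

lemma tan_proj_decomp: "v = tan_proj x v + (x \<bullet> v) *\<^sub>R x"
  by (simp add: tan_proj_def)

text \<open>A rotation taking a coordinate vector to \<open>x\<close> reduces the claim to an
  identity matrix with one column replaced.\<close>

lemma det_add_rank_one:
  fixes x d :: "real^'n"
  assumes "norm x = 1"
  shows "det (matrix (\<lambda>w. w + (x \<bullet> w) *\<^sub>R d)) = 1 + x \<bullet> d"
proof -
  \<comment> \<open>An arbitrary index; index types are nonempty.\<close>
  obtain k :: 'n where True by simp
  obtain f where f: "orthogonal_transformation f" and fx: "f (axis k (1::real)) = x"
    using orthogonal_transformation_exists_1[of "axis k 1" x] assms by auto
  have lin: "linear f" and bij: "bij f"
    using f by (auto simp: orthogonal_transformation_linear orthogonal_transformation_bij)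
  define g where "g = inv f"
  have fg [simp]: "f (g w) = w" "g (f w) = w" for w
    using bij by (auto simp: g_def bij_def surj_f_inv_f)
  have ling: "linear g"
    using f by (simp add: g_def orthogonal_transformation_inv orthogonal_transformation_linear)
  have ff: "f v \<bullet> f w = v \<bullet> w" for v w
    using f by (simp add: orthogonal_transformation_def)
  let ?L = "\<lambda>w. w + (x \<bullet> w) *\<^sub>R d"
  have linL: "linear ?L"
    by (rule linearI) (simp_all add: algebra_simps inner_add_right)
  let ?y = "axis k 1 + g d"
  \<comment> \<open>In rotated coordinates the map is \<open>w + (w $ k) *\<^sub>R g d\<close>,
    which alters column \<open>k\<close> only; \<open>cramer_lemma\<close> then reads off the
    determinant.\<close>
  have "matrix (g \<circ> ?L \<circ> f) = (\<chi> i j. if j = k then ((mat 1 :: real^'n^'n) *v ?y) $ i else mat 1 $ i $ j)"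
  proof -
    have "(g \<circ> ?L \<circ> f) w = w + (w $ k) *\<^sub>R g d" for w
      using ling ff[of "axis k 1" w]
      by (simp add: fx linear_add linear_scale inner_axis')
    then show ?thesis
      by (simp add: matrix_def vec_eq_iff fun_eq_iff) (auto simp: axis_def mat_def)
  qed
  then have "det (matrix (g \<circ> ?L \<circ> f)) = ?y $ k"
    by (simp add: cramer_lemma)
  also have "?y $ k = 1 + x \<bullet> d"
    using ff[of "axis k 1" "g d"] by (simp add: fx inner_axis')
  finally have 1: "det (matrix (g \<circ> ?L \<circ> f)) = 1 + x \<bullet> d" .
  have "matrix (g \<circ> ?L \<circ> f) = matrix g ** matrix ?L ** matrix f"
    using lin ling linL by (simp add: matrix_compose linear_compose)
  then have "det (matrix (g \<circ> ?L \<circ> f)) = det (matrix ?L) * (det (matrix g) * det (matrix f))"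
    by (simp add: det_mul)
  also have "det (matrix g) * det (matrix f) = det (matrix (g \<circ> f))"
    using lin ling by (simp add: matrix_compose det_mul)
  also have "g \<circ> f = id" by auto
  also have "matrix id = (mat 1 :: real^'n^'n)" by (rule matrix_id_mat_1)
  finally show ?thesis using 1 by (metis det_I mult.right_neutral)
qed

lemma linear_tan_extension:
  fixes A :: "'a::real_inner \<Rightarrow> 'a"
  assumes "linear (\<lambda>v. A (tan_proj x v))"
  shows "linear (\<lambda>v. A (tan_proj x v) + (x \<bullet> v) *\<^sub>R c)"
  by (rule linear_compose_add[OF assms], rule linearI) (simp_all add: algebra_simps inner_add_right)

text \<open>Changing the image of the normal \<open>x\<close> from \<open>x\<close> to
  \<open>c\<close> amounts to composing with a rank-one perturbation of the identity, because the
  range of \<open>A\<close> is tangent. Hence only the normal component of \<open>c\<close> counts.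
  The cone map and the shell map both have derivatives of this shape.\<close>

lemma det_tan_extension:
  fixes x c :: "real^'n"
  assumes x: "norm x = 1" and lin: "linear (\<lambda>v. A (tan_proj x v))"
    and tan: "\<And>v. x \<bullet> A (tan_proj x v) = 0"
  shows "det (matrix (\<lambda>v. A (tan_proj x v) + (x \<bullet> v) *\<^sub>R c)) = (x \<bullet> c) * tan_det x A"
proof -
  let ?M = "\<lambda>v. A (tan_proj x v) + (x \<bullet> v) *\<^sub>R x" and ?L = "\<lambda>w. w + (x \<bullet> w) *\<^sub>R (c - x)"
  have "(\<lambda>v. A (tan_proj x v) + (x \<bullet> v) *\<^sub>R c) = ?L \<circ> ?M"
    using x by (auto simp: fun_eq_iff inner_add_right tan dot_square_norm algebra_simps)
  moreover have "linear ?L"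
    by (rule linearI) (simp_all add: algebra_simps inner_add_right)
  ultimately have "det (matrix (\<lambda>v. A (tan_proj x v) + (x \<bullet> v) *\<^sub>R c))
      = det (matrix ?L) * det (matrix ?M)"
    using linear_tan_extension[OF lin] by (simp add: matrix_compose det_mul)
  also have "det (matrix ?L) = x \<bullet> c"
    using x by (simp add: det_add_rank_one inner_diff_right dot_square_norm)
  finally show ?thesis by (simp add: tan_det_def)
qed

text \<open>Along the segment from the identity to \<open>f\<close> the quadratic form stays
  positive, so every map on it is injective. The determinant is continuous and nonzero there and
  starts at 1.\<close>

lemma det_pos_if_positive_form:
  fixes f :: "real^'n \<Rightarrow> real^'n"
  assumes lin: "linear f" and pos: "\<And>v. v \<noteq> 0 \<Longrightarrow> v \<bullet> f v > 0"
  shows "det (matrix f) > 0"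
proof -
  let ?g = "\<lambda>s v. (1 - s) *\<^sub>R v + s *\<^sub>R f v"
  define p where "p s = det (matrix (?g s))" for s
  have ling: "linear (?g s)" for s
    by (intro linear_compose_add linear_compose_scale_right lin) (simp_all add: linear_id[unfolded id_def])
  have nz: "p s \<noteq> 0" if "0 \<le> s" "s \<le> 1" for s
  proof -
    have "?g s v \<noteq> 0" if "v \<noteq> 0" for v
    proof -
      have "v \<bullet> ?g s v = (1 - s) * (v \<bullet> v) + s * (v \<bullet> f v)"
        by (simp add: inner_add_right)
      also have "\<dots> > 0"
        using \<open>0 \<le> s\<close> \<open>s \<le> 1\<close> pos[OF that] that
        by (cases "s = 0") (auto intro!: add_nonneg_pos mult_pos_pos)
      finally show ?thesis by auto
    qed
    then have "inj (?g s)"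
      using linear_injective_0[OF ling] by blast
    then show ?thesis
      using det_nz_iff_inj[OF ling] by (simp add: p_def)
  qed
  have "matrix (?g s) = (\<chi> i j. (1 - s) * mat 1 $ i $ j + s * matrix f $ i $ j)" for s
    by (auto simp: matrix_def vec_eq_iff mat_def axis_def)
  then have "p = (\<lambda>s. det (\<chi> i j. (1 - s) * mat 1 $ i $ j + s * matrix f $ i $ j))"
    by (auto simp: p_def)
  then have cont: "continuous_on {0..1} p"
    by (simp add: det_def) (intro continuous_intros)
  have p0: "p 0 = 1"
    by (simp add: p_def matrix_id_mat_1[unfolded id_def])
  have "p 1 > 0"
  proof (rule ccontr)
    assume "\<not> p 1 > 0"
    then obtain s where "0 \<le> s" "s \<le> 1" "p s = 0"
      using IVT2'[of p 1 0 0] cont p0 by auto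
    then show False using nz by blast
  qed
  then show ?thesis by (simp add: p_def)
qed

text \<open>Extending \<open>A\<close> by the identity on the normal line adds
  \<open>(x \<bullet> v)\<^sup>2\<close> to its quadratic form, which becomes positive on the whole
  space.\<close>

lemma tan_det_pos:
  assumes x: "norm x = 1" and lin: "linear (\<lambda>v. A (tan_proj x v))"
    and tan: "\<And>v. x \<bullet> A (tan_proj x v) = 0"
    and pos: "\<And>v. x \<bullet> v = 0 \<Longrightarrow> v \<noteq> 0 \<Longrightarrow> v \<bullet> A v > 0"
  shows "tan_det x A > 0"
  unfolding tan_det_def
proof (rule det_pos_if_positive_form)
  show "linear (\<lambda>v. A (tan_proj x v) + (x \<bullet> v) *\<^sub>R x)"
    by (rule linear_tan_extension[OF lin])
  fix v :: "real^'a" assume "v \<noteq> 0"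
  let ?w = "tan_proj x v"
  have "v \<bullet> (A ?w + (x \<bullet> v) *\<^sub>R x) = ?w \<bullet> A ?w + (x \<bullet> v)\<^sup>2"
    by (subst (1) tan_proj_decomp[of v x], simp only: inner_add_left inner_add_right)
      (simp add: tan x inner_commute[of _ x] power2_eq_square dot_square_norm)
  also have "\<dots> > 0"
  proof (cases "?w = 0")
    case True
    moreover have "A ?w = 0" using True linear_0[OF lin] linear_0[OF linear_tan_proj[of x]] by simp
    moreover have "x \<bullet> v \<noteq> 0"
      using tan_proj_decomp[of v x] True \<open>v \<noteq> 0\<close> by auto
    ultimately show ?thesis by simp
  next
    case False
    then show ?thesis using pos[of ?w] x by (simp add: add_pos_nonneg)
  qed
  finally show "v \<bullet> (A ?w + (x \<bullet> v) *\<^sub>R x) > 0" .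
qed

section \<open>Functions extended radially from the sphere\<close>

lemma has_derivative_sgn:
  fixes y :: "'a::real_inner"
  assumes "y \<noteq> 0"
  shows "(sgn has_derivative (\<lambda>v. tan_proj (sgn y) v /\<^sub>R norm y)) (at y)"
proof -
  have "((\<lambda>y. inverse (norm y) *\<^sub>R y) has_derivative
      (\<lambda>v. inverse (norm y) *\<^sub>R v + (- (inverse (norm y) * (sgn y \<bullet> v) * inverse (norm y))) *\<^sub>R y)) (at y)"
    using assms by (auto intro!: derivative_eq_intros has_derivative_norm simp: inner_commute algebra_simps)
  moreover have "(\<lambda>v. inverse (norm y) *\<^sub>R v + (- (inverse (norm y) * (sgn y \<bullet> v) * inverse (norm y))) *\<^sub>R y)
    = (\<lambda>v. tan_proj (sgn y) v /\<^sub>R norm y)"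
    by (auto simp: fun_eq_iff tan_proj_def sgn_div_norm algebra_simps)
  moreover have "sgn = (\<lambda>y::'a. inverse (norm y) *\<^sub>R y)"
    by (auto simp: sgn_div_norm)
  ultimately show ?thesis by simp
qed

lemma sgn_unit: "norm x = 1 \<Longrightarrow> sgn x = (x::'a::real_normed_vector)"
  by (simp add: sgn_div_norm)

lemma sgn_sgn_vector: "sgn (sgn y) = sgn (y::'a::real_normed_vector)"
  by (cases "y = 0") (simp_all add: sgn_unit norm_sgn)

text \<open>The function is constant on rays, so precomposing it with the dilation by the fixed
  factor \<open>1 / norm y\<close> does not change it, and this dilation carries \<open>y\<close> to
  \<open>sgn y\<close>.\<close>

lemma has_derivative_radial_scale:
  fixes f :: "'a::real_inner \<Rightarrow> 'b::real_normed_vector"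
  assumes y: "y \<noteq> 0" and f: "((\<lambda>y. f (sgn y)) has_derivative f') (at (sgn y))"
  shows "((\<lambda>y. f (sgn y)) has_derivative (\<lambda>v. f' (v /\<^sub>R norm y))) (at y)"
proof -
  have "((\<lambda>z. z /\<^sub>R norm y) has_derivative (\<lambda>v. v /\<^sub>R norm y)) (at y)"
    by (auto intro!: derivative_eq_intros)
  from has_derivative_compose[OF this, of "\<lambda>y. f (sgn y)" f'] f
  have "((\<lambda>z. f (sgn (z /\<^sub>R norm y))) has_derivative (\<lambda>v. f' (v /\<^sub>R norm y))) (at y)"
    by (simp add: sgn_div_norm[symmetric])
  then show ?thesis using y by (simp add: sgn_scaleR)
qed

text \<open>Since \<open>sgn\<close> is idempotent, the function equals its own composition with
  \<open>sgn\<close>, whose derivative at \<open>x\<close> is \<open>tan_proj x\<close>; uniqueness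
  of derivatives gives the claim.\<close>

lemma has_derivative_radial_tangent:
  fixes f :: "'a::real_inner \<Rightarrow> 'b::real_normed_vector"
  assumes x: "norm x = 1" and f: "((\<lambda>y. f (sgn y)) has_derivative f') (at x)"
  shows "f' (tan_proj x v) = f' v"
proof -
  have "x \<noteq> 0" using x by auto
  then have "(sgn has_derivative tan_proj x) (at x)"
    using has_derivative_sgn[of x] x by (simp add: sgn_unit)
  from has_derivative_compose[OF this, of "\<lambda>y. f (sgn y)" f'] f x
  have "((\<lambda>y. f (sgn y)) has_derivative (\<lambda>v. f' (tan_proj x v))) (at x)"
    by (simp add: sgn_unit sgn_sgn_vector)
  then have "(\<lambda>v. f' (tan_proj x v)) = f'"
    using f by (rule has_derivative_unique)
  then show ?thesis by (simp add: fun_eq_iff)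
qed

lemma GDERIV_unique:
  fixes f :: "'a::real_inner \<Rightarrow> real"
  assumes "GDERIV f x :> D" "GDERIV f x :> D'"
  shows "D = D'"
proof -
  have "(\<lambda>h. h \<bullet> D) = (\<lambda>h. h \<bullet> D')"
    using assms unfolding gderiv_def by (rule has_derivative_unique)
  then have "(D - D') \<bullet> (D - D') = 0"
    unfolding fun_eq_iff by (metis inner_diff_right right_minus_eq)
  then show ?thesis by simp
qed

lemma GDERIV_if_has_derivative:
  fixes f :: "'a::euclidean_space \<Rightarrow> real"
  assumes "(f has_derivative f') (at x)"
  shows "GDERIV f x :> (\<Sum>i\<in>Basis. f' i *\<^sub>R i)"
proof -
  have lin: "linear f'" using assms by (rule has_derivative_linear)
  have "f' h = h \<bullet> (\<Sum>i\<in>Basis. f' i *\<^sub>R i)" for h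
  proof -
    have "f' h = f' (\<Sum>i\<in>Basis. (h \<bullet> i) *\<^sub>R i)" by (simp add: euclidean_representation)
    also have "\<dots> = (\<Sum>i\<in>Basis. (h \<bullet> i) * f' i)"
      using lin by (simp add: linear_sum linear_scale)
    finally show ?thesis by (simp add: inner_sum_right mult.commute)
  qed
  then have "f' = (\<lambda>h. h \<bullet> (\<Sum>i\<in>Basis. f' i *\<^sub>R i))" by (rule ext)
  then show ?thesis unfolding gderiv_def by (rule has_derivative_eq_rhs[OF assms])
qed

lemma sphere_grad_eqI: "GDERIV (\<lambda>y. f (sgn y)) x :> D \<Longrightarrow> sphere_grad f x = D"
  unfolding sphere_grad_def by (rule the_equality) (simp_all add: GDERIV_unique)

lemma GDERIV_sphere_grad:
  fixes f :: "'a::euclidean_space \<Rightarrow> real"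
  assumes "(\<lambda>y. f (sgn y)) differentiable (at x)"
  shows "GDERIV (\<lambda>y. f (sgn y)) x :> sphere_grad f x"
proof -
  obtain D where "GDERIV (\<lambda>y. f (sgn y)) x :> D"
    using assms GDERIV_if_has_derivative unfolding differentiable_def by blast
  then show ?thesis using sphere_grad_eqI by metis
qed

section \<open>Smooth convex bodies with positive curvature\<close>

lemma support_fun_attained:
  assumes "compact \<Omega>" "\<Omega> \<noteq> {}"
  shows "\<exists>z\<in>\<Omega>. support_fun \<Omega> z0 x = x \<bullet> (z - z0) \<and> (\<forall>w\<in>\<Omega>. x \<bullet> (w - z0) \<le> x \<bullet> (z - z0))"
proof -
  have "continuous_on \<Omega> (\<lambda>z. x \<bullet> (z - z0))"
    by (intro continuous_intros)
  then obtain z where z: "z \<in> \<Omega>" "\<And>w. w \<in> \<Omega> \<Longrightarrow> x \<bullet> (w - z0) \<le> x \<bullet> (z - z0)"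
    using continuous_attains_sup[OF assms] by blast
  have "support_fun \<Omega> z0 x = x \<bullet> (z - z0)"
    unfolding support_fun_def using z by (intro cSup_eq_maximum) auto
  then show ?thesis using z by blast
qed

lemma support_fun_shift:
  assumes "compact \<Omega>" "\<Omega> \<noteq> {}"
  shows "support_fun \<Omega> z0 x = support_fun \<Omega> 0 x - x \<bullet> z0"
proof -
  obtain z w where
    z: "z \<in> \<Omega>" "support_fun \<Omega> z0 x = x \<bullet> (z - z0)" "\<forall>w\<in>\<Omega>. x \<bullet> (w - z0) \<le> x \<bullet> (z - z0)" and
    w: "w \<in> \<Omega>" "support_fun \<Omega> 0 x = x \<bullet> (w - 0)" "\<forall>z\<in>\<Omega>. x \<bullet> (z - 0) \<le> x \<bullet> (w - 0)"
    using support_fun_attained[OF assms] by meson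
  then show ?thesis
    using z(3)[rule_format, OF w(1)] w(3)[rule_format, OF z(1)] unfolding inner_diff_right inner_zero_right
    by linarith
qed

text \<open>The factor \<open>norm y\<close> of the product rule cancels the
  \<open>1 / norm y\<close> of \<open>has_derivative_radial_scale\<close>, so the derivative depends
  on \<open>sgn y\<close> only.\<close>

lemma has_derivative_radial_cone:
  fixes Q :: "'a::real_inner \<Rightarrow> 'b::real_normed_vector"
  assumes y: "y \<noteq> 0" and Q: "((\<lambda>y. Q (sgn y)) has_derivative L) (at (sgn y))"
  shows "((\<lambda>y. norm y *\<^sub>R Q (sgn y)) has_derivative (\<lambda>v. (sgn y \<bullet> v) *\<^sub>R Q (sgn y) + L v)) (at y)"
proof -
  have L: "L (v /\<^sub>R norm y) = L v /\<^sub>R norm y" for v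
    using has_derivative_linear[OF Q] by (simp add: linear_scale)
  show ?thesis
    by (rule has_derivative_eq_rhs[OF has_derivative_scaleR[OF has_derivative_norm[OF y]
          has_derivative_radial_scale[OF y Q]]])
      (use y in \<open>auto simp: fun_eq_iff L inner_commute\<close>)
qed

text \<open>\<open>sgn 0 = 0\<close> lies off the sphere, where \<open>f\<close> is uncontrolled;
  the indicator removes this point.\<close>

lemma radial_measurable:
  fixes f :: "'a::euclidean_space \<Rightarrow> real"
  assumes f: "continuous_on (sphere 0 1) f"
  shows "(\<lambda>y. indicator (- {0}) y *\<^sub>R f (sgn y)) \<in> borel_measurable borel"
proof -
  have "continuous_on (- {0}) (\<lambda>y. f (sgn y))"
    by (rule continuous_on_compose2[OF f])
      (auto intro!: continuous_intros simp: norm_sgn split: if_splits)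
  then show ?thesis
    by (intro borel_measurable_continuous_on_indicator) auto
qed

lemma radial_integrable:
  fixes f :: "'a::euclidean_space \<Rightarrow> real"
  assumes f: "continuous_on (sphere 0 1) f"
  shows "set_integrable lborel (cball 0 1 - {0}) (\<lambda>y. f (sgn y))"
proof -
  let ?S = "cball 0 1 - {0::'a}"
  let ?g = "\<lambda>y. indicator (- {0}) y *\<^sub>R f (sgn y)"
  obtain B where B: "\<And>x. norm x = 1 \<Longrightarrow> \<bar>f x\<bar> \<le> B"
    using compact_imp_bounded[OF compact_continuous_image[OF f]]
    unfolding bounded_iff by (metis compact_sphere image_eqI mem_sphere_0 real_norm_def)
  have "set_integrable lborel ?S ?g"
    unfolding set_integrable_def
  proof (rule integrableI_bounded_set_indicator[where B = B])
    show "AE y in lborel. y \<in> ?S \<longrightarrow> norm (?g y) \<le> B"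
      using B by (auto simp: norm_sgn)
    show "emeasure lborel ?S < \<infinity>"
      using emeasure_lborel_cball_finite[of "0::'a" 1]
      by (rule le_less_trans[OF emeasure_mono[of _ "cball 0 1"], rotated 2]) auto
  qed (use radial_measurable[OF f] in auto)
  moreover have "(\<lambda>y. indicator ?S y *\<^sub>R ?g y) = (\<lambda>y. indicator ?S y *\<^sub>R f (sgn y))"
    by (auto simp: indicator_def)
  ultimately show ?thesis unfolding set_integrable_def by (simp only:)
qed

text \<open>A single time slice. Pointwise differentiability of the support function and of its
  gradient suffices for the change of variables formula applied to the boundary
  parametrisation.\<close>

locale smooth_body =
  fixes \<Omega> :: "(real^'n) set" and h :: "real^'n \<Rightarrow> real"
  assumes body: "convex_body \<Omega>"
    and h_eq: "x \<in> sphere 0 1 \<Longrightarrow> h x = support_fun \<Omega> 0 x"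
    and diff_h: "norm x = 1 \<Longrightarrow> (\<lambda>y. h (sgn y)) differentiable (at x)"
    and diff_grad: "norm x = 1 \<Longrightarrow> (\<lambda>y. sphere_grad h (sgn y)) differentiable (at x)"
    and hess_pos: "norm x = 1 \<Longrightarrow> x \<bullet> v = 0 \<Longrightarrow> v \<noteq> 0 \<Longrightarrow> v \<bullet> hess_plus h x v > 0"
begin

text \<open>The Euclidean gradient at \<open>x\<close> of the extension of \<open>h\<close> that is
  homogeneous of degree 1.\<close>

definition touch :: "real^'n \<Rightarrow> real^'n" where
  "touch x = h x *\<^sub>R x + sphere_grad h x"

lemma compact: "compact \<Omega>" and convex: "convex \<Omega>" and interior_ne: "interior \<Omega> \<noteq> {}"
  and nonempty: "\<Omega> \<noteq> {}"
  using body interior_subset[of \<Omega>] by (auto simp: convex_body_def)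

lemma inner_le_h: "norm x = 1 \<Longrightarrow> z \<in> \<Omega> \<Longrightarrow> x \<bullet> z \<le> h x"
  using support_fun_attained[OF compact nonempty, of 0 x] h_eq[of x] by auto

lemma h_attained: "norm x = 1 \<Longrightarrow> \<exists>z\<in>\<Omega>. x \<bullet> z = h x"
  using support_fun_attained[OF compact nonempty, of 0 x] h_eq[of x] by auto

lemma has_derivative_h:
  "norm x = 1 \<Longrightarrow> ((\<lambda>y. h (sgn y)) has_derivative (\<lambda>v. v \<bullet> sphere_grad h x)) (at x)"
  using GDERIV_sphere_grad[OF diff_h] by (simp add: gderiv_def)

text \<open>The radial extension is constant along the ray through \<open>x\<close>.\<close>

lemma grad_tangent: "norm x = 1 \<Longrightarrow> x \<bullet> sphere_grad h x = 0"
  using has_derivative_radial_tangent[OF _ has_derivative_h, of x x] by simp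

text \<open>The derivative of \<open>h\<close> contributes a normal term, which cancels the normal
  part of the ambient derivative of the gradient. What remains is tangent and equals
  \<open>hess_plus\<close>: the inverse of the Weingarten map.\<close>

lemma has_derivative_touch:
  assumes x: "norm x = 1"
  shows "((\<lambda>y. touch (sgn y)) has_derivative (\<lambda>v. hess_plus h x (tan_proj x v))) (at x)"
    and "x \<bullet> hess_plus h x (tan_proj x v) = 0"
proof -
  have x0: "x \<noteq> 0" using x by auto
  let ?N = "sphere_grad h"
  define D where "D = frechet_derivative (\<lambda>y. ?N (sgn y)) (at x)"
  have D: "((\<lambda>y. ?N (sgn y)) has_derivative D) (at x)"
    using diff_grad[OF x] by (simp add: D_def frechet_derivative_works)
  have sgn: "(sgn has_derivative tan_proj x) (at x)"
    using has_derivative_sgn[OF x0] x by (simp add: sgn_unit)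
  have Dtan: "D (tan_proj x v) = D v" for v
    using has_derivative_radial_tangent[OF x D] .
  \<comment> \<open>Differentiating the identity \<open>sgn y \<bullet> ?N (sgn y) = 0\<close> gives
    the normal part of \<open>D v\<close>.\<close>
  have Dx: "x \<bullet> D v = - (?N x \<bullet> v)" for v
  proof -
    have "((\<lambda>y. sgn y \<bullet> ?N (sgn y)) has_derivative (\<lambda>v. x \<bullet> D v + tan_proj x v \<bullet> ?N x)) (at x)"
      using has_derivative_inner[OF sgn D] x by (simp add: sgn_unit)
    moreover have "((\<lambda>y. sgn y \<bullet> ?N (sgn y)) has_derivative (\<lambda>v. 0)) (at x)"
    proof (rule has_derivative_transform_within_open[OF has_derivative_const[of 0]])
      show "open (- {0::real^'n})" by auto
    qed (use x0 grad_tangent in \<open>auto simp: norm_sgn\<close>)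
    ultimately have "(\<lambda>v. x \<bullet> D v + tan_proj x v \<bullet> ?N x) = (\<lambda>v. 0)"
      by (rule has_derivative_unique)
    then have "x \<bullet> D v + tan_proj x v \<bullet> ?N x = 0"
      by (simp add: fun_eq_iff)
    then show ?thesis
      using grad_tangent[OF x] by (simp add: tan_proj_def inner_diff_left inner_commute[of v])
  qed
  have hess: "hess_plus h x (tan_proj x v) = D v + (?N x \<bullet> v) *\<^sub>R x + h x *\<^sub>R tan_proj x v" for v
    by (simp add: hess_plus_def sphere_cov_def D_def[symmetric] Dtan)
      (simp add: tan_proj_def[of x "D v"] Dx)
  have "((\<lambda>y. touch (sgn y)) has_derivative
     (\<lambda>v. (h x *\<^sub>R tan_proj x v + (v \<bullet> ?N x) *\<^sub>R x) + D v)) (at x)"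
    unfolding touch_def
    using has_derivative_add[OF has_derivative_scaleR[OF has_derivative_h[OF x] sgn] D] x
    by (simp add: sgn_unit)
  then show "((\<lambda>y. touch (sgn y)) has_derivative (\<lambda>v. hess_plus h x (tan_proj x v))) (at x)"
    by (rule has_derivative_eq_rhs) (simp add: fun_eq_iff hess inner_commute)
  show "x \<bullet> hess_plus h x (tan_proj x v) = 0"
    using x by (simp add: hess inner_add_right Dx dot_square_norm)
qed

lemma linear_hess: "norm x = 1 \<Longrightarrow> linear (\<lambda>v. hess_plus h x (tan_proj x v))"
  using has_derivative_touch(1) by (rule has_derivative_linear)

lemma tan_det_hess_pos: "norm x = 1 \<Longrightarrow> tan_det x (hess_plus h x) > 0"
  by (rule tan_det_pos[OF _ linear_hess]) (simp_all add: has_derivative_touch(2) hess_pos)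

text \<open>The function \<open>norm y * h (sgn y) - y \<bullet> p\<close> is nonnegative because
  \<open>p\<close> lies in the body and vanishes at \<open>x\<close>, so its gradient there,
  \<open>touch x - p\<close>, is zero.\<close>

lemma touch_unique:
  assumes x: "norm x = 1" and p: "p \<in> \<Omega>" "x \<bullet> p = h x"
  shows "p = touch x"
proof -
  have x0: "x \<noteq> 0" using x by auto
  have "((\<lambda>y. norm y *\<^sub>R h (sgn y) - y \<bullet> p) has_derivative
      (\<lambda>v. ((x \<bullet> v) *\<^sub>R h x + v \<bullet> sphere_grad h x) - v \<bullet> p)) (at x)"
    using has_derivative_radial_cone[OF x0, of h] has_derivative_h[OF x] x
    by (intro has_derivative_diff) (auto intro!: derivative_eq_intros simp: sgn_unit)
  moreover have "\<forall>\<^sub>F y in at x. norm x *\<^sub>R h (sgn x) - x \<bullet> p \<le> norm y *\<^sub>R h (sgn y) - y \<bullet> p"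
  proof (rule always_eventually, rule allI)
    fix y :: "real^'n"
    show "norm x *\<^sub>R h (sgn x) - x \<bullet> p \<le> norm y *\<^sub>R h (sgn y) - y \<bullet> p"
    proof (cases "y = 0")
      case False
      then have "sgn y \<bullet> p \<le> h (sgn y)"
        by (intro inner_le_h p) (simp add: norm_sgn)
      then have "norm y * (sgn y \<bullet> p) \<le> norm y * h (sgn y)"
        by (rule mult_left_mono) simp
      moreover have "norm y * (sgn y \<bullet> p) = y \<bullet> p"
        using False by (simp add: sgn_div_norm)
      ultimately show ?thesis using x p by (simp add: sgn_unit)
    qed (use x p in \<open>simp add: sgn_unit\<close>)
  qed
  ultimately have "(\<lambda>v. ((x \<bullet> v) *\<^sub>R h x + v \<bullet> sphere_grad h x) - v \<bullet> p) = (\<lambda>v. 0)"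
    by (rule has_derivative_local_min)
  then have "v \<bullet> (touch x - p) = 0" for v
    by (simp add: fun_eq_iff touch_def inner_diff_right inner_add_right inner_commute mult.commute)
  from this[of "touch x - p"] show ?thesis by simp
qed

lemma touch_in: "norm x = 1 \<Longrightarrow> touch x \<in> \<Omega>"
  and inner_touch: "norm x = 1 \<Longrightarrow> x \<bullet> touch x = h x"
  using h_attained[of x] touch_unique[of x] by auto

section \<open>Uniqueness of the outer normal at a boundary point\<close>

lemma opposite_h: "norm x = 1 \<Longrightarrow> h x + h (- x) > 0"
proof -
  assume x: "norm x = 1"
  obtain z where "z \<in> interior \<Omega>" using interior_ne by auto
  then obtain e where e: "e > 0" "cball z e \<subseteq> \<Omega>"
    using mem_interior_cball by blast
  have "z + e *\<^sub>R x \<in> \<Omega>"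
    using e x by (intro subsetD[OF e(2)]) (simp add: dist_norm)
  then have "x \<bullet> (z + e *\<^sub>R x) \<le> h x"
    using x by (intro inner_le_h)
  moreover have "z \<in> \<Omega>" using \<open>z \<in> interior \<Omega>\<close> interior_subset by blast
  then have "(- x) \<bullet> z \<le> h (- x)"
    using x by (intro inner_le_h) auto
  ultimately show ?thesis
    using e x by (simp add: inner_add_right dot_square_norm)
qed

text \<open>Normals at a fixed point form a convex cone. Two distinct unit normals at one point
  would make \<open>touch\<close> constant along the arc between them, so its derivative would
  vanish in a nonzero tangent direction, against \<open>hess_pos\<close>.\<close>

lemma inj_touch:
  assumes x: "norm x = 1" and y: "norm y = 1" and eq: "touch x = touch y"
  shows "x = y"
proof (rule ccontr)
  assume "x \<noteq> y"
  let ?p = "touch x" and ?w = "y - x"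
  have "x \<noteq> 0" using x by auto
  \<comment> \<open>The width of the body is positive, so antipodal normals cannot share a point.
    This keeps the chord from \<open>x\<close> to \<open>y\<close> away from the origin.\<close>
  have opp: "y \<noteq> - x"
    using opposite_h[OF x] inner_touch[OF x] inner_touch[OF y] eq by auto
  have nz: "x + s *\<^sub>R ?w \<noteq> 0" if "s \<in> {0..1}" for s
  proof
    assume "x + s *\<^sub>R ?w = 0"
    then have *: "(1 - s) *\<^sub>R x = (- s) *\<^sub>R y" by (simp add: algebra_simps)
    then have "norm ((1 - s) *\<^sub>R x) = norm ((- s) *\<^sub>R y)" by simp
    then have "s = 1/2" using that x y by simp
    with * have "(1/2) *\<^sub>R x = (1/2) *\<^sub>R (- y)" by simp
    then have "x = - y" by (simp only: scaleR_left_imp_eq[of "1/2" x "- y"])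
    with opp show False by simp
  qed
  have const: "touch (sgn (x + s *\<^sub>R ?w)) = ?p" if s: "s \<in> {0..1}" for s
  proof -
    let ?v = "x + s *\<^sub>R ?w"
    have v: "norm (sgn ?v) = 1" using nz[OF s] by (simp add: norm_sgn)
    obtain q where q: "q \<in> \<Omega>" "sgn ?v \<bullet> q = h (sgn ?v)"
      using h_attained[OF v] by blast
    have vq: "?v \<bullet> q = (1 - s) * (x \<bullet> q) + s * (y \<bullet> q)" for q
      by (simp add: inner_add_left inner_diff_left algebra_simps)
    have "?v \<bullet> q \<le> ?v \<bullet> ?p"
      unfolding vq using s inner_le_h[OF x q(1)] inner_le_h[OF y q(1)] inner_touch[OF x]
        inner_touch[OF y] eq by (intro add_mono mult_left_mono) auto
    then have "sgn ?v \<bullet> q \<le> sgn ?v \<bullet> ?p"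
      unfolding sgn_div_norm inner_scaleR_left by (rule mult_left_mono) simp
    then have "sgn ?v \<bullet> ?p = h (sgn ?v)"
      using q inner_le_h[OF v touch_in[OF x]] by linarith
    then show ?thesis
      using touch_unique[OF v touch_in[OF x]] by simp
  qed
  have "((\<lambda>s. x + s *\<^sub>R ?w) has_derivative (\<lambda>s. s *\<^sub>R ?w)) (at (0::real))"
    by (auto intro!: derivative_eq_intros)
  from has_derivative_compose[OF this, of "\<lambda>y. touch (sgn y)"] has_derivative_touch(1)[OF x]
  have "((\<lambda>s. touch (sgn (x + s *\<^sub>R ?w))) has_derivative
      (\<lambda>s. hess_plus h x (tan_proj x (s *\<^sub>R ?w)))) (at 0)" by simp
  then have "((\<lambda>s. touch (sgn (x + s *\<^sub>R ?w))) has_vector_derivative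
      hess_plus h x (tan_proj x ?w)) (at 0)"
    using linear_scale[OF linear_hess[OF x]] by (simp add: has_vector_derivative_def)
  then have 1: "((\<lambda>s. touch (sgn (x + s *\<^sub>R ?w))) has_vector_derivative
      hess_plus h x (tan_proj x ?w)) (at 0 within {0..1})"
    by (rule has_vector_derivative_at_within)
  \<comment> \<open>Constancy is known for parameters in \<open>{0..1}\<close> only, so the two
    derivatives are compared one-sidedly at 0.\<close>
  have 2: "((\<lambda>s. touch (sgn (x + s *\<^sub>R ?w))) has_vector_derivative 0) (at 0 within {0..1})"
    by (rule has_vector_derivative_transform[OF _ _ has_vector_derivative_const[of ?p]])
      (use const in auto)
  have zero: "hess_plus h x (tan_proj x ?w) = 0"
    by (rule vector_derivative_unique_within[OF _ 1 2]) (simp add: trivial_limit_within islimpt_Icc)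
  have "tan_proj x ?w = 0"
  proof (rule ccontr)
    assume nz: "tan_proj x ?w \<noteq> 0"
    show False using hess_pos[OF x _ nz] x zero by simp
  qed
  then have "y = (1 + x \<bullet> ?w) *\<^sub>R x"
    using tan_proj_decomp[of ?w x] by (simp add: algebra_simps)
  then obtain c where c: "y = c *\<^sub>R x" by blast
  then have "\<bar>c\<bar> = 1" using x y by simp
  then show False using c \<open>x \<noteq> y\<close> opp by (auto simp: abs_if split: if_splits)
qed

section \<open>Body, interior and boundary in terms of the support function\<close>

lemma mem_iff: "z \<in> \<Omega> \<longleftrightarrow> (\<forall>x. norm x = 1 \<longrightarrow> x \<bullet> z \<le> h x)"
proof
  assume R: "\<forall>x. norm x = 1 \<longrightarrow> x \<bullet> z \<le> h x"
  show "z \<in> \<Omega>"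
  proof (rule ccontr)
    assume "z \<notin> \<Omega>"
    then obtain a b where ab: "a \<bullet> z < b" "\<And>w. w \<in> \<Omega> \<Longrightarrow> a \<bullet> w > b"
      using separating_hyperplane_closed_point[OF convex compact_imp_closed[OF compact]] by blast
    then have "a \<noteq> 0" using nonempty by auto
    \<comment> \<open>The separation theorem puts the body on the side where \<open>a\<close> is
      larger, so the outer normal is \<open>- a\<close>.\<close>
    then have x: "norm (sgn (- a)) = 1" by (simp add: norm_sgn)
    have *: "sgn (- a) \<bullet> w = - (a \<bullet> w) / norm a" for w
      by (simp add: sgn_div_norm divide_inverse mult.commute)
    obtain q where q: "q \<in> \<Omega>" "sgn (- a) \<bullet> q = h (sgn (- a))"
      using h_attained[OF x] by blast
    have "h (sgn (- a)) < sgn (- a) \<bullet> z"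
      using ab(1) ab(2)[OF q(1)] \<open>a \<noteq> 0\<close> unfolding q(2)[symmetric] *
      by (intro divide_strict_right_mono) auto
    then show False using R x by force
  qed
qed (use inner_le_h in auto)

lemma interior_iff: "z \<in> interior \<Omega> \<longleftrightarrow> (\<forall>x. norm x = 1 \<longrightarrow> x \<bullet> z < h x)"
proof
  assume "z \<in> interior \<Omega>"
  then obtain e where e: "e > 0" "cball z e \<subseteq> \<Omega>"
    using mem_interior_cball by blast
  show "\<forall>x. norm x = 1 \<longrightarrow> x \<bullet> z < h x"
  proof (intro allI impI)
    fix x :: "real^'n" assume x: "norm x = 1"
    have "z + e *\<^sub>R x \<in> \<Omega>"
      using e x by (intro subsetD[OF e(2)]) (simp add: dist_norm)
    then have "x \<bullet> (z + e *\<^sub>R x) \<le> h x"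
      using x by (intro inner_le_h)
    then show "x \<bullet> z < h x" using e x by (simp add: inner_add_right dot_square_norm)
  qed
next
  assume R: "\<forall>x. norm x = 1 \<longrightarrow> x \<bullet> z < h x"
  then have z: "z \<in> \<Omega>" using mem_iff by (simp add: less_imp_le)
  show "z \<in> interior \<Omega>"
  proof (rule ccontr)
    assume "z \<notin> interior \<Omega>"
    then have "z \<notin> rel_interior \<Omega>"
      using rel_interior_nonempty_interior[OF interior_ne] by simp
    from supporting_hyperplane_rel_boundary[OF convex z this]
    obtain a where a: "a \<noteq> 0" "\<And>w. w \<in> \<Omega> \<Longrightarrow> a \<bullet> z \<le> a \<bullet> w"
      by metis
    then have x: "norm (sgn (- a)) = 1" by (simp add: norm_sgn)
    have *: "sgn (- a) \<bullet> w = - (a \<bullet> w) / norm a" for w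
      by (simp add: sgn_div_norm divide_inverse mult.commute)
    obtain q where q: "q \<in> \<Omega>" "sgn (- a) \<bullet> q = h (sgn (- a))"
      using h_attained[OF x] by blast
    have "h (sgn (- a)) \<le> sgn (- a) \<bullet> z"
      using a(2)[OF q(1)] unfolding q(2)[symmetric] *
      by (intro divide_right_mono) auto
    then show False using R x by force
  qed
qed

lemma frontier_eq: "frontier \<Omega> = touch ` sphere 0 1"
proof -
  have fr: "frontier \<Omega> = \<Omega> - interior \<Omega>"
    using compact by (simp add: frontier_def closure_closed compact_imp_closed)
  show ?thesis
  proof (intro equalityI subsetI)
    fix p assume "p \<in> frontier \<Omega>"
    then have p: "p \<in> \<Omega>" "p \<notin> interior \<Omega>" by (auto simp: fr)
    then obtain x where x: "norm x = 1" "h x \<le> x \<bullet> p"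
      unfolding interior_iff by (metis not_less)
    then have "p = touch x"
      using touch_unique[OF x(1) p(1)] inner_le_h[OF x(1) p(1)] by linarith
    then show "p \<in> touch ` sphere 0 1" using x by auto
  next
    fix p assume "p \<in> touch ` sphere 0 1"
    then obtain x where x: "norm x = 1" "p = touch x" by auto
    then show "p \<in> frontier \<Omega>"
      using touch_in inner_touch interior_iff by (fastforce simp: fr)
  qed
qed

lemma continuous_on_h: "continuous_on (sphere 0 1) h"
  and continuous_on_touch: "continuous_on (sphere 0 1) touch"
proof -
  have *: "continuous_on (sphere 0 1) f"
    if "\<And>x. norm x = 1 \<Longrightarrow> \<exists>f'. ((\<lambda>y. f (sgn y)) has_derivative f') (at x)"
    for f :: "real^'n \<Rightarrow> 'b::real_normed_vector"
  proof -
    have "continuous_on (sphere 0 1) (\<lambda>y. f (sgn y))"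
      using that by (intro continuous_at_imp_continuous_on) (metis has_derivative_continuous mem_sphere_0)
    then show ?thesis by (rule continuous_on_eq) (simp add: sgn_unit)
  qed
  show "continuous_on (sphere 0 1) h" using has_derivative_h by (intro * ) blast
  show "continuous_on (sphere 0 1) touch" using has_derivative_touch(1) by (intro * ) blast
qed

section \<open>Gauss map and Gauss curvature\<close>

lemma gauss_map_touch: "norm x = 1 \<Longrightarrow> gauss_map \<Omega> (touch x) = x"
  unfolding gauss_map_def
proof (rule the_equality)
  assume x: "norm x = 1"
  then show "norm x = 1 \<and> (\<forall>z\<in>\<Omega>. x \<bullet> z \<le> x \<bullet> touch x)"
    using inner_le_h inner_touch by simp
  fix \<nu> assume \<nu>: "norm \<nu> = 1 \<and> (\<forall>z\<in>\<Omega>. \<nu> \<bullet> z \<le> \<nu> \<bullet> touch x)"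
  then have "h \<nu> \<le> \<nu> \<bullet> touch x"
    using h_attained[of \<nu>] by force
  then have "touch x = touch \<nu>"
    using touch_unique[OF conjunct1[OF \<nu>] touch_in[OF x]] inner_le_h[OF conjunct1[OF \<nu>] touch_in[OF x]]
    by linarith
  then show "\<nu> = x" using inj_touch x \<nu> by metis
qed

lemma inv_gauss_map: "norm x = 1 \<Longrightarrow> inv_into (frontier \<Omega>) (gauss_map \<Omega>) x = touch x"
  by (rule inv_into_f_eq) (auto simp: inj_on_def frontier_eq gauss_map_touch)

text \<open>The Gauss map inverts \<open>touch\<close> and is continuous because the sphere is
  compact, so it is differentiable within the boundary. Its chosen derivative \<open>D\<close> is
  arbitrary in the normal direction; \<open>tan_det\<close> uses it on tangent vectors only, where
  it is the inverse of \<open>hess_plus\<close>.\<close>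

lemma gauss_curvature_touch:
  assumes x: "norm x = 1"
  shows "gauss_curvature \<Omega> (touch x) = 1 / tan_det x (hess_plus h x)"
proof -
  let ?A = "\<lambda>v. hess_plus h x (tan_proj x v)" and ?F = "frontier \<Omega>"
  let ?M = "\<lambda>v. ?A v + (x \<bullet> v) *\<^sub>R x"
  have x0: "x \<noteq> 0" using x by auto
  have linM: "linear ?M" by (rule linear_tan_extension[OF linear_hess[OF x]])
  have detM: "det (matrix ?M) = tan_det x (hess_plus h x)" by (simp add: tan_det_def)
  then have "det (matrix ?M) \<noteq> 0" using tan_det_hess_pos[OF x] by simp
  then have "inj ?M" using det_nz_iff_inj[OF linM] by simp
  then obtain B where B: "linear B" "\<And>v. B (?M v) = v"
    using linear_injective_isomorphism[OF linM] by blast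
  \<comment> \<open>The added term vanishes on the sphere, so it does not affect the derivative
    within the sphere, but it completes the tangential derivative to the invertible map
    \<open>?M\<close>.\<close>
  have "((\<lambda>y. touch (sgn y) + (norm y - 1) *\<^sub>R x) has_derivative ?M) (at x within sphere 0 1)"
    by (rule has_derivative_at_withinI, rule has_derivative_add[OF has_derivative_touch(1)[OF x]])
      (use x x0 in \<open>auto intro!: derivative_eq_intros has_derivative_norm simp: inner_commute sgn_unit\<close>)
  then have der_touch: "(touch has_derivative ?M) (at x within sphere 0 1)"
    by (rule has_derivative_transform[rotated 2]) (use x in \<open>auto simp: sgn_unit\<close>)
  have "(gauss_map \<Omega> has_derivative B) (at (touch x) within touch ` sphere 0 1)"
  proof (rule has_derivative_inverse_within[OF der_touch])
    have "continuous_on (touch ` sphere 0 1) (gauss_map \<Omega>)"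
      by (rule continuous_on_inv[OF continuous_on_touch]) (auto simp: gauss_map_touch)
    then show "continuous (at (touch x) within touch ` sphere 0 1) (gauss_map \<Omega>)"
      using x by (simp add: continuous_on_eq_continuous_within)
  qed (use x B in \<open>auto simp: gauss_map_touch fun_eq_iff\<close>)
  then have diff: "gauss_map \<Omega> differentiable (at (touch x) within ?F)"
    unfolding frontier_eq differentiable_def by blast
  define D where "D = frechet_derivative (gauss_map \<Omega>) (at (touch x) within ?F)"
  have D: "(gauss_map \<Omega> has_derivative D) (at (touch x) within ?F)"
    using diff by (simp add: D_def frechet_derivative_works)
  have linD: "linear D" using D by (rule has_derivative_linear)
  \<comment> \<open>A derivative within the frontier is pinned down on tangent vectors by curves in the frontier.\<close>
  have DA: "D (?A v) = tan_proj x v" for v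
  proof (cases "tan_proj x v = 0")
    case True
    then show ?thesis
      using linear_0[OF linD] linear_0[OF linear_hess[OF x]] linear_0[OF linear_tan_proj[of x]] by simp
  next
    case False
    have nz: "x + s *\<^sub>R tan_proj x v \<noteq> 0" for s
    proof
      assume "x + s *\<^sub>R tan_proj x v = 0"
      then have "x \<bullet> (x + s *\<^sub>R tan_proj x v) = 0" by simp
      then show False using x by (simp add: inner_add_right dot_square_norm)
    qed
    let ?c = "\<lambda>s. x + s *\<^sub>R tan_proj x v"
    have tt: "tan_proj x (tan_proj x v) = tan_proj x v"
      using x by (simp add: tan_proj_tangent)
    have c: "(?c has_derivative (\<lambda>s. s *\<^sub>R tan_proj x v)) (at (0::real))"
      by (auto intro!: derivative_eq_intros)
    have "((\<lambda>s. touch (sgn (?c s))) has_derivative (\<lambda>s. ?A (s *\<^sub>R tan_proj x v))) (at 0)"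
      using has_derivative_compose[OF c, of "\<lambda>y. touch (sgn y)"] has_derivative_touch(1)[OF x] by simp
    then have "((\<lambda>s. gauss_map \<Omega> (touch (sgn (?c s)))) has_derivative
        (\<lambda>s. D (?A (s *\<^sub>R tan_proj x v)))) (at 0)"
    proof (rule has_derivative_in_compose)
      show "(gauss_map \<Omega> has_derivative D) (at (touch (sgn (?c 0))) within range (\<lambda>s. touch (sgn (?c s))))"
        using D nz x unfolding frontier_eq
        by (auto intro!: has_derivative_subset[OF D[unfolded frontier_eq]] simp: sgn_unit norm_sgn)
    qed
    then have 1: "((\<lambda>s. sgn (?c s)) has_derivative (\<lambda>s. D (?A (s *\<^sub>R tan_proj x v)))) (at 0)"
      using nz by (simp add: gauss_map_touch norm_sgn)
    have "(sgn has_derivative tan_proj x) (at (?c 0))"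
      using has_derivative_sgn[OF x0] x by (simp add: sgn_unit)
    then have 2: "((\<lambda>s. sgn (?c s)) has_derivative (\<lambda>s. tan_proj x (s *\<^sub>R tan_proj x v))) (at 0)"
      by (rule has_derivative_compose[OF c])
    have "D (?A (1 *\<^sub>R tan_proj x v)) = tan_proj x (1 *\<^sub>R tan_proj x v)"
      using has_derivative_unique[OF 1 2] by (rule fun_cong)
    then show ?thesis by (simp add: tt)
  qed
  let ?E = "\<lambda>w. D (tan_proj x w) + (x \<bullet> w) *\<^sub>R x"
  have linE: "linear ?E"
    using linear_compose[OF linear_tan_proj[of x] linD] by (intro linear_tan_extension) (simp add: o_def)
  \<comment> \<open>\<open>?M\<close> keeps the normal component \<open>x \<bullet> v\<close>, and
    \<open>D\<close> undoes \<open>?A\<close> on the tangent part.\<close>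
  have "?E \<circ> ?M = id"
  proof
    fix v
    have xM: "x \<bullet> ?M v = x \<bullet> v"
      using x by (simp add: inner_add_right has_derivative_touch(2) dot_square_norm)
    have "tan_proj x (?M v) = ?A v"
      using xM by (simp add: tan_proj_def[of x "?M v"])
    then have "?E (?M v) = D (?A v) + (x \<bullet> v) *\<^sub>R x"
      using xM by simp
    also have "\<dots> = v" using DA tan_proj_decomp[of v x] by simp
    finally show "(?E \<circ> ?M) v = id v" by simp
  qed
  then have "matrix ?E ** matrix ?M = mat 1"
    using matrix_compose[OF linM linE] by (simp add: matrix_id_mat_1)
  then have "det (matrix ?E) * det (matrix ?M) = 1"
    unfolding det_mul[symmetric] by simp
  moreover have "gauss_curvature \<Omega> (touch x) = det (matrix ?E)"
    by (simp add: gauss_curvature_def gauss_map_touch[OF x] tan_det_def D_def[symmetric])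
  ultimately show ?thesis
    using \<open>det (matrix ?M) \<noteq> 0\<close> detM by (simp add: field_simps)
qed

text \<open>The normals to the body parametrise it by a cone map whose Jacobian is the integrand.\<close>

lemma measure_eq_cone_integral:
  assumes z: "z \<in> interior \<Omega>" and K: "continuous_on (sphere 0 1) K"
    "\<And>x. norm x = 1 \<Longrightarrow> K x > 0"
    "\<And>x. norm x = 1 \<Longrightarrow> tan_det x (hess_plus h x) = 1 / K x"
  defines "\<rho> \<equiv> \<lambda>x. (h x - x \<bullet> z) / K x"
  shows "measure lborel \<Omega> = (LINT y:cball 0 1 - {0}|lborel. \<rho> (sgn y))"
proof -
  let ?S = "cball (0::real^'n) 1 - {0}"
  let ?f = "\<lambda>y. norm y *\<^sub>R (touch (sgn y) - z)"
  let ?f' = "\<lambda>y v. hess_plus h (sgn y) (tan_proj (sgn y) v) + (sgn y \<bullet> v) *\<^sub>R (touch (sgn y) - z)"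
  \<comment> \<open>The value at the origin is set to 0 because \<open>sgn 0\<close> is not on the
    sphere; this makes \<open>?J\<close> Borel on the whole space.\<close>
  let ?J = "\<lambda>y. if y = 0 then 0 else \<rho> (sgn y)"
  have \<rho>: "continuous_on (sphere 0 1) \<rho>"
    unfolding \<rho>_def using K(2) by (intro continuous_intros continuous_on_h K(1)) force
  have J: "?J \<in> borel_measurable borel"
    by (rule measurable_cong[THEN iffD1, OF _ radial_measurable[OF \<rho>]]) auto
  have eq: "indicator ?S y *\<^sub>R ?J y = indicator ?S y *\<^sub>R \<rho> (sgn y)" for y :: "real^'n"
    by (auto simp: indicator_def)
  have "set_integrable lborel ?S (\<lambda>y. \<rho> (sgn y))"
    by (rule radial_integrable[OF \<rho>])
  then have int: "set_integrable lborel ?S ?J"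
    unfolding set_integrable_def eq .
  have der: "(?f has_derivative ?f' y) (at y)" if "y \<in> ?S" for y
  proof -
    have y: "y \<noteq> 0" "norm (sgn y) = 1" using that by (auto simp: norm_sgn)
    have "((\<lambda>y. touch (sgn y) - z) has_derivative
        (\<lambda>v. hess_plus h (sgn y) (tan_proj (sgn y) v) - 0)) (at (sgn y))"
      by (intro has_derivative_diff has_derivative_touch(1) y) simp
    from has_derivative_radial_cone[OF y(1), of "\<lambda>y. touch y - z", OF this]
    show ?thesis by (rule has_derivative_eq_rhs) (simp add: fun_eq_iff)
  qed
  have pos: "h x - x \<bullet> z > 0" if "norm x = 1" for x
    using z that by (simp add: interior_iff)
  have inj: "inj_on ?f ?S"
  proof (rule inj_onI)
    \<comment> \<open>Pairing the common image with the normal \<open>sgn y\<close> gives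
      \<open>norm y\<close> times a positive number on one side, and at most \<open>norm y'\<close>
      times the same number on the other, as \<open>sgn y\<close> attains its support value at its
      own touching point.\<close>
    have le: "norm y \<le> norm y'" if "y \<in> ?S" "y' \<in> ?S" "?f y = ?f y'" for y y'
    proof -
      let ?x = "sgn y"
      have x: "norm ?x = 1" "norm (sgn y') = 1" using that by (auto simp: norm_sgn)
      have "norm y * (h ?x - ?x \<bullet> z) = ?x \<bullet> ?f y"
        using x by (simp add: inner_diff_right inner_touch)
      also have "\<dots> = norm y' * (?x \<bullet> (touch (sgn y') - z))"
        by (simp add: that)
      also have "\<dots> \<le> norm y' * (h ?x - ?x \<bullet> z)"
        using inner_le_h[OF x(1) touch_in[OF x(2)]] by (intro mult_left_mono) (auto simp: inner_diff_right)
      finally show ?thesis using pos[OF x(1)] by simp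
    qed
    fix y y' assume y: "y \<in> ?S" "y' \<in> ?S" and eq: "?f y = ?f y'"
    then have n: "norm y = norm y'" using le[of y y'] le[of y' y] by simp
    then have "touch (sgn y) = touch (sgn y')" using eq y by auto
    moreover have "norm (sgn y) = 1" "norm (sgn y') = 1" using y by (auto simp: norm_sgn)
    ultimately have "sgn y = sgn y'" using inj_touch by metis
    then have "norm y *\<^sub>R sgn y = norm y' *\<^sub>R sgn y'" using n by simp
    then show "y = y'" using y by (simp add: sgn_div_norm)
  qed
  have img: "?f ` ?S = (\<lambda>w. - z + w) ` \<Omega> - {0}"
  proof (intro equalityI subsetI)
    fix w assume "w \<in> ?f ` ?S"
    then obtain y where y: "y \<in> ?S" "w = ?f y" by (rule imageE) blast
    then have x: "norm (sgn y) = 1" by (auto simp: norm_sgn)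
    have "sgn y \<bullet> w > 0"
      using y pos[OF x] x by (simp add: inner_diff_right inner_touch)
    then have "w \<noteq> 0" by auto
    have "z \<in> \<Omega>" using z interior_subset by blast
    then have "(1 - norm y) *\<^sub>R z + norm y *\<^sub>R touch (sgn y) \<in> \<Omega>"
      using y by (intro convexD_alt[OF convex] touch_in x) auto
    moreover have "(1 - norm y) *\<^sub>R z + norm y *\<^sub>R touch (sgn y) = w + z"
      unfolding y(2) by (simp add: algebra_simps)
    ultimately have "w + z \<in> \<Omega>" by simp
    then show "w \<in> (\<lambda>w. - z + w) ` \<Omega> - {0}"
      using \<open>w \<noteq> 0\<close> by (auto intro!: image_eqI[of _ _ "w + z"])
  next
    fix w assume "w \<in> (\<lambda>w. - z + w) ` \<Omega> - {0}"
    then have w: "w \<noteq> 0" "z + w \<in> \<Omega>" by auto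
    \<comment> \<open>The maximum of \<open>?t\<close> over directions is the gauge of
      \<open>\<Omega> - z\<close> at \<open>w\<close>. A maximising direction is a normal at the
      boundary point where the ray from \<open>z\<close> in direction \<open>w\<close> leaves the
      body; hence the preimage \<open>t *\<^sub>R x\<close>.\<close>
    let ?t = "\<lambda>x. (x \<bullet> w) / (h x - x \<bullet> z)"
    have "continuous_on (sphere 0 1) ?t"
      using pos by (intro continuous_intros continuous_on_h) force
    moreover have "sphere (0::real^'n) 1 \<noteq> {}"
      using vector_choose_size[of 1] by (metis dist_0_norm mem_sphere empty_iff zero_le_one)
    ultimately obtain x where x: "norm x = 1" and max: "\<And>y. norm y = 1 \<Longrightarrow> ?t y \<le> ?t x"
      using continuous_attains_sup[OF compact_sphere, of 0 1 ?t] by auto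
    have "0 < ?t (sgn w)"
      using w pos[of "sgn w"] by (intro divide_pos_pos) (auto simp: norm_sgn sgn_div_norm)
    define t where "t = ?t x"
    have t0: "0 < t" using \<open>0 < ?t (sgn w)\<close> max[of "sgn w"] w by (simp add: norm_sgn t_def)
    have t1: "t \<le> 1"
      using pos[OF x] inner_le_h[OF x w(2)] by (simp add: inner_add_right t_def)
    let ?p = "z + w /\<^sub>R t"
    have xw: "x \<bullet> w = t * (h x - x \<bullet> z)" using pos[OF x] by (simp add: t_def)
    have "?p \<in> \<Omega>"
      unfolding mem_iff
    proof (intro allI impI)
      fix y :: "real^'n" assume y: "norm y = 1"
      have "y \<bullet> w = ?t y * (h y - y \<bullet> z)" using pos[OF y] by simp
      also have "\<dots> \<le> t * (h y - y \<bullet> z)"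
        using pos[OF y] max[OF y] unfolding t_def by (intro mult_right_mono) auto
      finally have "(y \<bullet> w) / t \<le> h y - y \<bullet> z"
        unfolding pos_divide_le_eq[OF t0] by (simp only: mult.commute)
      then show "y \<bullet> ?p \<le> h y"
        by (simp only: inner_add_right inner_scaleR_right) (simp add: field_simps)
    qed
    moreover have "x \<bullet> ?p = h x"
      unfolding inner_add_right inner_scaleR_right xw using t0 by (simp add: field_simps)
    ultimately have p: "?p = touch x" by (rule touch_unique[OF x])
    let ?y = "t *\<^sub>R x"
    have y: "norm ?y = t" "sgn ?y = x"
      using x t0 by (simp_all add: sgn_scaleR sgn_unit)
    have "?f ?y = w"
      unfolding y p[symmetric] using t0 by simp
    moreover have "?y \<in> ?S" using y t0 t1 x by auto
    ultimately show "w \<in> ?f ` ?S" by (intro image_eqI[of w ?f ?y]) simp_all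
  qed
  have "compact ((\<lambda>w. - z + w) ` \<Omega>)"
    by (rule compact_translation[OF compact])
  then have meas: "(\<lambda>w. - z + w) ` \<Omega> \<in> sets borel"
    by (simp add: borel_compact)
  have "\<bar>det (matrix (?f' y))\<bar> = ?J y" if "y \<in> ?S" for y
  proof -
    have x: "norm (sgn y) = 1" using that by (auto simp: norm_sgn)
    show ?thesis
      using that pos[OF x] K(2)[OF x] x
      by (simp add: det_tan_extension[OF x linear_hess[OF x]] has_derivative_touch(2) K(3)
          inner_diff_right inner_touch \<rho>_def)
  qed
  then have "measure lborel (?f ` ?S) = (LINT y:?S|lborel. ?J y)"
    using der inj J int meas by (intro measure_injective_image[where f' = ?f']) (auto simp: img)
  also have "\<dots> = (LINT y:?S|lborel. \<rho> (sgn y))"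
    unfolding set_lebesgue_integral_def eq ..
  also have "measure lborel (?f ` ?S) = measure lborel ((\<lambda>w. - z + w) ` \<Omega>)"
    unfolding img using meas by (intro measure_Diff_null_set) auto
  also have "\<dots> = measure lebesgue ((\<lambda>w. - z + w) ` \<Omega>)"
    using meas by simp
  also have "\<dots> = measure lebesgue \<Omega>"
    by (rule measure_translation)
  also have "\<dots> = measure lborel \<Omega>"
    using compact by (simp add: borel_compact)
  finally show "measure lborel \<Omega> = (LINT y:?S|lborel. \<rho> (sgn y))" .
qed

end

section \<open>The mean over the sphere\<close>

lemma space_sphere_measure [simp]: "space (sphere_measure :: (real^'n) measure) = sphere 0 1"
  and sets_sphere_measure [simp]:
    "sets (sphere_measure :: (real^'n) measure) = sets (restrict_space borel (sphere 0 1))"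
  by (simp_all add: sphere_measure_def)

lemma sgn_measurable_sphere:
  "sgn \<in> restrict_space lborel (cball 0 1 - {0}) \<rightarrow>\<^sub>M restrict_space borel (sphere (0::real^'n) 1)"
proof (rule measurable_restrict_space2)
  have "(\<lambda>y::real^'n. y /\<^sub>R norm y) \<in> borel_measurable lborel"
    by measurable
  then show "(sgn :: real^'n \<Rightarrow> _) \<in> borel_measurable (restrict_space lborel (cball 0 1 - {0}))"
    by (intro measurable_restrict_space1) (simp add: sgn_div_norm[abs_def])
qed (auto simp: space_restrict_space norm_sgn split: if_splits)

lemma integral_sphere_measure:
  fixes f :: "real^'n \<Rightarrow> real"
  assumes f: "continuous_on (sphere 0 1) f"
  shows "(LINT x|sphere_measure. f x) = real CARD('n) * (LINT y:cball 0 1 - {0}|lborel. f (sgn y))"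
proof -
  have [measurable]: "f \<in> borel_measurable (restrict_space borel (sphere 0 1))"
    by (rule borel_measurable_continuous_on_restrict[OF f])
  note sgn_measurable_sphere[measurable]
  have "(LINT x|sphere_measure. f x) =
      (LINT x|distr (restrict_space lborel (cball 0 1 - {0})) (restrict_space borel (sphere 0 1)) sgn.
        real CARD('n) *\<^sub>R f x)"
    unfolding sphere_measure_def by (rule integral_density) auto
  also have "\<dots> = (LINT y|restrict_space lborel (cball 0 1 - {0}). real CARD('n) *\<^sub>R f (sgn y))"
    by (rule integral_distr) auto
  also have "\<dots> = real CARD('n) * (LINT y:cball 0 1 - {0}|lborel. f (sgn y))"
    by (simp add: integral_restrict_space set_lebesgue_integral_def)
  finally show ?thesis .
qed

lemma content_unit_cball_pos: "measure lborel (cball (0::real^'n) 1) > 0"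
  using content_cball_pos[of 1 "0::real^'n"] by simp

text \<open>The factor \<open>CARD('n)\<close> in \<open>sphere_measure\<close> occurs in the
  integral and in the total area and cancels. Means over the sphere become averages of radially
  constant functions over the unit ball, which makes them comparable with volumes.\<close>

lemma sphere_mean_eq:
  fixes f :: "real^'n \<Rightarrow> real"
  assumes f: "continuous_on (sphere 0 1) f"
  shows "sphere_mean f = (LINT y:cball 0 1 - {0}|lborel. f (sgn y)) / measure lborel (cball (0::real^'n) 1)"
proof -
  have "measure sphere_measure (sphere (0::real^'n) 1) = (LINT x::real^'n|sphere_measure. 1)"
    by simp
  also have "\<dots> = real CARD('n) * (LINT y:cball (0::real^'n) 1 - {0}|lborel. 1)"
    by (rule integral_sphere_measure) (rule continuous_on_const)
  also have "(LINT y:cball (0::real^'n) 1 - {0}|lborel. (1::real)) = measure lborel (cball (0::real^'n) 1 - {0})"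
    by (simp add: set_lebesgue_integral_def)
  also have "\<dots> = measure lborel (cball (0::real^'n) 1)"
    by (intro measure_Diff_null_set) auto
  finally show ?thesis
    by (simp add: sphere_mean_def integral_sphere_measure[OF f])
qed

lemma sphere_mean_cong:
  fixes f g :: "real^'n \<Rightarrow> real"
  assumes "\<And>x. norm x = 1 \<Longrightarrow> f x = g x"
  shows "sphere_mean f = sphere_mean g"
proof -
  have "(LINT x|sphere_measure. f x) = (LINT x|sphere_measure. g x)"
    using assms by (intro Bochner_Integration.integral_cong) auto
  then show ?thesis by (simp add: sphere_mean_def)
qed

lemma sphere_mean_const: "sphere_mean (\<lambda>x::real^'n. c) = c"
proof -
  have "(LINT y:cball (0::real^'n) 1 - {0}|lborel. c) = c * measure lborel (cball (0::real^'n) 1 - {0})"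
    by (simp add: set_lebesgue_integral_def)
  also have "measure lborel (cball (0::real^'n) 1 - {0}) = measure lborel (cball (0::real^'n) 1)"
    by (intro measure_Diff_null_set) auto
  finally show ?thesis
    using content_unit_cball_pos[where 'n = 'n] by (simp add: sphere_mean_eq)
qed

context
  fixes f g :: "real^'n \<Rightarrow> real"
  assumes f: "continuous_on (sphere 0 1) f" and g: "continuous_on (sphere 0 1) g"
begin

lemma sphere_mean_diff: "sphere_mean (\<lambda>x. f x - g x) = sphere_mean f - sphere_mean g"
  using f g
  by (simp add: sphere_mean_eq continuous_on_diff set_integral_diff radial_integrable diff_divide_distrib)

lemma sphere_mean_cmult: "sphere_mean (\<lambda>x. c * f x) = c * sphere_mean f"
  using f by (simp add: sphere_mean_eq continuous_on_mult_left)

lemma sphere_mean_mono: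
  assumes "\<And>x. norm x = 1 \<Longrightarrow> f x \<le> g x"
  shows "sphere_mean f \<le> sphere_mean g"
proof -
  have "(LINT y:cball 0 1 - {0}|lborel. f (sgn y)) \<le> (LINT y:cball 0 1 - {0}|lborel. g (sgn y))"
    using assms by (intro set_integral_mono radial_integrable f g) (auto simp: norm_sgn)
  then show ?thesis
    using content_unit_cball_pos[where 'n = 'n] by (simp add: sphere_mean_eq f g divide_right_mono)
qed

end

section \<open>Regularity of functions that are smooth on the sphere times an interval\<close>

lemma smooth_differentiable:
  assumes "\<forall>k. C_k_on k U g" "p \<in> U"
  shows "g differentiable (at p)"
  using assms(1)[rule_format, of 1] assms(2) by simp

lemma smooth_frechet_derivative:
  assumes "\<forall>k. C_k_on k U g"
  shows "\<forall>k. C_k_on k U (\<lambda>p. frechet_derivative g (at p) v)"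
  using assms by (metis C_k_on.simps(2))

text \<open>\<open>C_k_on\<close> controls derivatives along fixed vectors, so the gradient is
  expanded over \<open>Basis\<close> into such directional derivatives of the ambient extension
  \<open>g\<close>. The inner sum is the derivative along \<open>x\<close> and removes the normal
  component.\<close>

lemma sphere_grad_extension:
  fixes g :: "'a::euclidean_space \<times> real \<Rightarrow> real"
  assumes x: "norm x = 1" and U: "open U" "(x, s) \<in> U" and g: "g differentiable (at (x, s))"
    and eq: "\<And>y. norm y = 1 \<Longrightarrow> (y, s) \<in> U \<Longrightarrow> g (y, s) = f y"
  shows "((\<lambda>y. f (sgn y)) has_derivative (\<lambda>v. frechet_derivative g (at (x, s)) (tan_proj x v, 0))) (at x)"
    and "sphere_grad f x = (\<Sum>i\<in>Basis. (frechet_derivative g (at (x, s)) (i, 0)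
      - (x \<bullet> i) * (\<Sum>j\<in>Basis. (x \<bullet> j) * frechet_derivative g (at (x, s)) (j, 0))) *\<^sub>R i)"
proof -
  let ?D = "frechet_derivative g (at (x, s))"
  have D: "(g has_derivative ?D) (at (x, s))"
    using g by (simp add: frechet_derivative_works)
  have x0: "x \<noteq> 0" using x by auto
  have "(sgn has_derivative tan_proj x) (at x)"
    using has_derivative_sgn[OF x0] x by (simp add: sgn_unit)
  then have "((\<lambda>y. (sgn y, s)) has_derivative (\<lambda>v. (tan_proj x v, 0))) (at x)"
    by (intro has_derivative_Pair) auto
  then have 1: "((\<lambda>y. g (sgn y, s)) has_derivative (\<lambda>v. ?D (tan_proj x v, 0))) (at x)"
    by (rule has_derivative_compose) (use D x in \<open>simp add: sgn_unit\<close>)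
  let ?V = "{y. y \<noteq> 0 \<and> (sgn y, s) \<in> U}"
  have "open ((- {0}) \<inter> (\<lambda>y. (sgn y, s)) -` U)"
    by (rule continuous_open_preimage) (use U in \<open>auto intro!: continuous_intros\<close>)
  also have "(- {0}) \<inter> (\<lambda>y. (sgn y, s)) -` U = ?V" by auto
  finally have "open ?V" .
  from has_derivative_transform_within_open[OF 1 this]
  show der: "((\<lambda>y. f (sgn y)) has_derivative (\<lambda>v. ?D (tan_proj x v, 0))) (at x)"
    using x0 U x by (simp add: sgn_unit norm_sgn eq)
  have lin: "linear ?D" using D by (rule has_derivative_linear)
  have lin': "linear (\<lambda>v. ?D (v, 0))"
    using linear_compose[of "\<lambda>v. (v, 0)" ?D] lin by (simp add: o_def linear_iff)
  have sum: "?D (v, 0) = (\<Sum>j\<in>Basis. (v \<bullet> j) * ?D (j, 0))" for v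
  proof -
    have "?D (v, 0) = ?D (\<Sum>j\<in>Basis. (v \<bullet> j) *\<^sub>R j, 0)"
      by (simp add: euclidean_representation)
    also have "\<dots> = (\<Sum>j\<in>Basis. (v \<bullet> j) * ?D (j, 0))"
      by (subst linear_sum[OF lin']) (simp add: linear_scale[OF lin'])
    finally show ?thesis .
  qed
  have "?D (tan_proj x i, 0) = ?D (i, 0) - (x \<bullet> i) * ?D (x, 0)" for i
    using linear_diff[OF lin'] linear_scale[OF lin'] by (simp add: tan_proj_def)
  then have "?D (tan_proj x i, 0) = ?D (i, 0) - (x \<bullet> i) * (\<Sum>j\<in>Basis. (x \<bullet> j) * ?D (j, 0))" for i
    using sum[of x] by simp
  with sphere_grad_eqI[OF GDERIV_if_has_derivative[OF der]]
  show "sphere_grad f x = (\<Sum>i\<in>Basis. (?D (i, 0) - (x \<bullet> i) * (\<Sum>j\<in>Basis. (x \<bullet> j) * ?D (j, 0))) *\<^sub>R i)"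
    by simp
qed

locale smooth_family =
  fixes u :: "'a::euclidean_space \<Rightarrow> real \<Rightarrow> real" and I :: "real set"
  assumes smooth: "smooth_on_set (sphere 0 1 \<times> I) (\<lambda>(x, t). u x t)"
begin

lemma local_extension:
  assumes "norm x = 1" "t \<in> I"
  obtains U g where "open U" "(x, t) \<in> U" "\<forall>k. C_k_on k U g"
    "\<And>y s. (y, s) \<in> U \<Longrightarrow> norm y = 1 \<Longrightarrow> s \<in> I \<Longrightarrow> g (y, s) = u y s"
proof -
  have "(x, t) \<in> sphere 0 1 \<times> I" using assms by simp
  then obtain U g where "open U" "(x, t) \<in> U" "\<forall>k. C_k_on k U g"
    "\<forall>p\<in>U \<inter> sphere 0 1 \<times> I. g p = (case p of (x, t) \<Rightarrow> u x t)"
    using smooth unfolding smooth_on_set_def by meson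
  then show thesis by (intro that) auto
qed

text \<open>\<open>G\<close> and \<open>H\<close> are built from an ambient extension of
  \<open>u\<close>, hence are differentiable at \<open>(x, t)\<close> in the full sense even if
  \<open>t\<close> is an endpoint of \<open>I\<close>; they represent the gradient and
  \<open>u\<close> only at times in \<open>I\<close>.\<close>

lemma radial_extension:
  assumes x: "norm x = 1" and t: "t \<in> I"
  obtains W G H where "open W" "(x, t) \<in> W" "G differentiable (at (x, t))" "H differentiable (at (x, t))"
    "\<And>y s. (y, s) \<in> W \<Longrightarrow> s \<in> I \<Longrightarrow> sphere_grad (\<lambda>z. u z s) (sgn y) = G (y, s)"
    "\<And>y s. (y, s) \<in> W \<Longrightarrow> s \<in> I \<Longrightarrow> u (sgn y) s = H (y, s)"
proof -
  obtain U g where U: "open U" "(x, t) \<in> U" and g: "\<forall>k. C_k_on k U g"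
    and eq: "\<And>y s. (y, s) \<in> U \<Longrightarrow> norm y = 1 \<Longrightarrow> s \<in> I \<Longrightarrow> g (y, s) = u y s"
    by (rule local_extension[OF x t]) (rule that; assumption)
  let ?d = "\<lambda>i p. frechet_derivative g (at p) (i, 0)"
  let ?G = "\<lambda>p. (\<Sum>i\<in>Basis. (?d i (sgn (fst p), snd p)
      - (sgn (fst p) \<bullet> i) * (\<Sum>j\<in>Basis. (sgn (fst p) \<bullet> j) * ?d j (sgn (fst p), snd p))) *\<^sub>R i)"
  let ?H = "\<lambda>p. g (sgn (fst p), snd p)"
  let ?W = "{p. fst p \<noteq> 0 \<and> (sgn (fst p), snd p) \<in> U}"
  have x0: "x \<noteq> 0" using x by auto
  have "open ({p. fst p \<noteq> 0} \<inter> (\<lambda>p. (sgn (fst p), snd p)) -` U)"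
  proof (rule continuous_open_preimage)
    show "open {p::'a \<times> real. fst p \<noteq> 0}"
      by (intro open_Collect_neq continuous_intros)
  qed (use U in \<open>auto intro!: continuous_intros\<close>)
  also have "{p. fst p \<noteq> 0} \<inter> (\<lambda>p. (sgn (fst p), snd p)) -` U = ?W" by auto
  finally have W: "open ?W" .
  have sgn: "(\<lambda>p::'a \<times> real. sgn (fst p)) differentiable (at (x, t))"
  proof -
    have "sgn differentiable (at x)"
      using has_derivative_sgn[OF x0] by (rule differentiableI)
    then show ?thesis
      by (intro differentiable_compose[of sgn fst]) (auto intro: linear_imp_differentiable linear_fst)
  qed
  then have pr: "(\<lambda>p::'a \<times> real. (sgn (fst p), snd p)) differentiable (at (x, t))"
    using has_derivative_Pair[OF _ has_derivative_snd[OF has_derivative_ident]]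
    unfolding differentiable_def by blast
  have H: "?H differentiable (at (x, t))"
    by (rule differentiable_compose[OF _ pr]) (use smooth_differentiable[OF g U(2)] x in \<open>simp add: sgn_unit\<close>)
  have d: "(\<lambda>p. ?d i (sgn (fst p), snd p)) differentiable (at (x, t))" for i
    by (rule differentiable_compose[OF _ pr])
      (use smooth_differentiable[OF smooth_frechet_derivative[OF g] U(2)] x in \<open>simp add: sgn_unit\<close>)
  have s: "(\<lambda>p. sgn (fst p) \<bullet> i) differentiable (at (x, t))" for i
    by (intro differentiable_inner sgn) simp
  have G: "?G differentiable (at (x, t))"
    by (intro differentiable_sum ballI differentiable_scaleR[OF _ differentiable_const]
        differentiable_diff differentiable_mult s d finite_Basis)
  show thesis
  proof (rule that[OF W _ G H])
    fix y s assume y: "(y, s) \<in> ?W" "s \<in> I"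
    then have "y \<noteq> 0" and U': "(sgn y, s) \<in> U" by simp_all
    then have n: "norm (sgn y) = 1" by (simp add: norm_sgn)
    show "sphere_grad (\<lambda>z. u z s) (sgn y) = ?G (y, s)"
      using sphere_grad_extension(2)[OF n U(1) U' smooth_differentiable[OF g U'], of "\<lambda>z. u z s"] eq y(2)
      by simp
    show "u (sgn y) s = ?H (y, s)" using eq[OF U' n y(2)] by simp
  qed (use x0 x U in \<open>simp add: sgn_unit\<close>)
qed

lemma differentiable_slice:
  assumes x: "norm x = 1" and t: "t \<in> I"
  shows "(\<lambda>y. u (sgn y) t) differentiable (at x)"
    and "(\<lambda>y. sphere_grad (\<lambda>z. u z t) (sgn y)) differentiable (at x)"
proof -
  obtain W G H where W: "open W" "(x, t) \<in> W" and G: "G differentiable (at (x, t))"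
    and H: "H differentiable (at (x, t))"
    and eq: "\<And>y s. (y, s) \<in> W \<Longrightarrow> s \<in> I \<Longrightarrow> sphere_grad (\<lambda>z. u z s) (sgn y) = G (y, s)"
    "\<And>y s. (y, s) \<in> W \<Longrightarrow> s \<in> I \<Longrightarrow> u (sgn y) s = H (y, s)"
    by (rule radial_extension[OF x t]) (rule that; assumption)
  have V: "open ((\<lambda>y. (y, t)) -` W)" "x \<in> (\<lambda>y. (y, t)) -` W"
    using W(2) by (auto intro!: open_vimage[OF W(1)] continuous_intros)
  have *: "G (y, t) = sphere_grad (\<lambda>z. u z t) (sgn y)" "H (y, t) = u (sgn y) t"
    if "y \<in> (\<lambda>y. (y, t)) -` W" for y
    using that eq(1)[OF _ t] eq(2)[OF _ t] by simp_all
  have pr: "((\<lambda>y. (y, t)) has_derivative (\<lambda>v. (v, 0))) (at x)"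
    by (intro has_derivative_Pair) auto
  obtain G' H' where G': "(G has_derivative G') (at (x, t))" and H': "(H has_derivative H') (at (x, t))"
    using G H unfolding differentiable_def by blast
  show "(\<lambda>y. u (sgn y) t) differentiable (at x)"
    using has_derivative_transform_within_open[OF has_derivative_compose[OF pr H'] V *(2)]
    by (rule differentiableI)
  show "(\<lambda>y. sphere_grad (\<lambda>z. u z t) (sgn y)) differentiable (at x)"
    using has_derivative_transform_within_open[OF has_derivative_compose[OF pr G'] V *(1)]
    by (rule differentiableI)
qed

text \<open>Around an interior time the representation by \<open>G\<close> and \<open>H\<close> is
  valid on an open set of space-time, so joint differentiability passes from them to
  \<open>u\<close> and its gradient.\<close>

lemma differentiable_interior:
  assumes x: "norm x = 1" and t: "t \<in> interior I"
  shows "(\<lambda>(y, s). u (sgn y) s) differentiable (at (x, t))"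
    and "(\<lambda>(y, s). sphere_grad (\<lambda>z. u z s) (sgn y)) differentiable (at (x, t))"
proof -
  have tI: "t \<in> I" using t interior_subset by blast
  obtain W G H where W: "open W" "(x, t) \<in> W" and G: "G differentiable (at (x, t))"
    and H: "H differentiable (at (x, t))"
    and eq: "\<And>y s. (y, s) \<in> W \<Longrightarrow> s \<in> I \<Longrightarrow> sphere_grad (\<lambda>z. u z s) (sgn y) = G (y, s)"
    "\<And>y s. (y, s) \<in> W \<Longrightarrow> s \<in> I \<Longrightarrow> u (sgn y) s = H (y, s)"
    by (rule radial_extension[OF x tI]) (rule that; assumption)
  have V: "open (W \<inter> UNIV \<times> interior I)" "(x, t) \<in> W \<inter> UNIV \<times> interior I"
    using W t by (auto intro!: open_Times)
  have "s \<in> I" if "s \<in> interior I" for s using that interior_subset by blast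
  then have *: "G p = (\<lambda>(y, s). sphere_grad (\<lambda>z. u z s) (sgn y)) p"
    "H p = (\<lambda>(y, s). u (sgn y) s) p" if "p \<in> W \<inter> UNIV \<times> interior I" for p
    using that eq by auto
  obtain G' H' where G': "(G has_derivative G') (at (x, t))" and H': "(H has_derivative H') (at (x, t))"
    using G H unfolding differentiable_def by blast
  show "(\<lambda>(y, s). sphere_grad (\<lambda>z. u z s) (sgn y)) differentiable (at (x, t))"
    using has_derivative_transform_within_open[OF G' V *(1)] by (rule differentiableI)
  show "(\<lambda>(y, s). u (sgn y) s) differentiable (at (x, t))"
    using has_derivative_transform_within_open[OF H' V *(2)] by (rule differentiableI)
qed

lemma continuous_on_family: "continuous_on (sphere 0 1 \<times> I) (\<lambda>(x, t). u x t)"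
  unfolding continuous_on_eq_continuous_within
proof
  fix p :: "'a \<times> real" assume p: "p \<in> sphere 0 1 \<times> I"
  then obtain x t where xt: "p = (x, t)" "norm x = 1" "t \<in> I" by auto
  obtain U g where U: "open U" "(x, t) \<in> U" and g: "\<forall>k. C_k_on k U g"
    and eq: "\<And>y s. (y, s) \<in> U \<Longrightarrow> norm y = 1 \<Longrightarrow> s \<in> I \<Longrightarrow> g (y, s) = u y s"
    by (rule local_extension[OF xt(2,3)]) (rule that; assumption)
  have "continuous (at p within sphere 0 1 \<times> I) g"
    using differentiable_imp_continuous_within[OF smooth_differentiable[OF g U(2)]] xt
    by (simp add: continuous_at_imp_continuous_at_within)
  then show "continuous (at p within sphere 0 1 \<times> I) (\<lambda>(x, t). u x t)"
    by (rule continuous_transform_within_openin[where S = "sphere 0 1 \<times> I \<inter> U"])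
      (use p U xt eq in auto)
qed

text \<open>Every point of \<open>I\<close> is a limit point, so derivatives within \<open>I\<close>
  are unique and \<open>d\<close> is the derivative of the local ambient extension in the direction
  \<open>(0, 1)\<close>, which is continuous.\<close>

lemma continuous_on_time_derivative:
  assumes limpt: "\<And>t. t \<in> I \<Longrightarrow> at t within I \<noteq> bot"
    and d: "\<And>x t. norm x = 1 \<Longrightarrow> t \<in> I \<Longrightarrow> ((\<lambda>s. u x s) has_real_derivative d x t) (at t within I)"
  shows "continuous_on (sphere 0 1 \<times> I) (\<lambda>(x, t). d x t)"
  unfolding continuous_on_eq_continuous_within
proof
  fix p :: "'a \<times> real" assume p: "p \<in> sphere 0 1 \<times> I"
  then obtain x t where xt: "p = (x, t)" "norm x = 1" "t \<in> I" by auto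
  obtain U g where U: "open U" "(x, t) \<in> U" and g: "\<forall>k. C_k_on k U g"
    and eq: "\<And>y s. (y, s) \<in> U \<Longrightarrow> norm y = 1 \<Longrightarrow> s \<in> I \<Longrightarrow> g (y, s) = u y s"
    by (rule local_extension[OF xt(2,3)]) (rule that; assumption)
  let ?d = "\<lambda>p. frechet_derivative g (at p) (0, 1)"
  have d_eq: "?d (y, s) = d y s" if ys: "(y, s) \<in> U" "norm y = 1" "s \<in> I" for y s
  proof -
    have D: "(g has_derivative frechet_derivative g (at (y, s))) (at (y, s))"
      using smooth_differentiable[OF g ys(1)] by (simp add: frechet_derivative_works)
    have pr: "((\<lambda>r. (y, r)) has_derivative (\<lambda>r. (0, r))) (at s)"
      by (intro has_derivative_Pair) auto
    have "(\<lambda>r. frechet_derivative g (at (y, s)) (0, r)) = (\<lambda>r. r *\<^sub>R ?d (y, s))"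
    proof
      show "frechet_derivative g (at (y, s)) (0, r) = r *\<^sub>R ?d (y, s)" for r
        using linear_scale[OF has_derivative_linear[OF D], of r "(0, 1)"] by simp
    qed
    then have "((\<lambda>r. g (y, r)) has_derivative (\<lambda>r. r *\<^sub>R ?d (y, s))) (at s)"
      by (rule has_derivative_eq_rhs[OF has_derivative_compose[OF pr D]])
    then have 1: "((\<lambda>r. g (y, r)) has_vector_derivative ?d (y, s)) (at s within I)"
      unfolding has_vector_derivative_def by (rule has_derivative_at_withinI)
    have op: "open ((\<lambda>r. (y, r)) -` U)"
      by (rule open_vimage[OF U(1)]) (intro continuous_intros)
    then obtain e where e: "e > 0" "\<And>r. dist r s < e \<Longrightarrow> (y, r) \<in> U"
      using ys(1) unfolding open_dist by auto
    have "((\<lambda>r. u y r) has_vector_derivative ?d (y, s)) (at s within I)"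
      by (rule has_vector_derivative_transform_within[OF 1 e(1) ys(3)]) (use e eq ys in auto)
    moreover have "((\<lambda>r. u y r) has_vector_derivative d y s) (at s within I)"
      using d[OF ys(2,3)] by (simp add: has_real_derivative_iff_has_vector_derivative)
    ultimately show ?thesis
      using vector_derivative_unique_within[OF limpt[OF ys(3)]] by blast
  qed
  have "continuous (at p within sphere 0 1 \<times> I) ?d"
    using differentiable_imp_continuous_within[OF
        smooth_differentiable[OF smooth_frechet_derivative[OF g] U(2)]] xt
    by (simp add: continuous_at_imp_continuous_at_within)
  then show "continuous (at p within sphere 0 1 \<times> I) (\<lambda>(x, t). d x t)"
    by (rule continuous_transform_within_openin[where S = "sphere 0 1 \<times> I \<inter> U"])
      (use p U xt d_eq in auto)
qed

end

section \<open>Volume along the flow\<close>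

text \<open>\<open>nontrivial\<close> makes time derivatives within \<open>I\<close> unique; the
  theorem treats an interval without two distinct times separately.\<close>

locale gauss_flow =
  fixes u :: "real^'n \<Rightarrow> real \<Rightarrow> real" and \<Omega> :: "real \<Rightarrow> (real^'n) set" and I :: "real set"
  assumes interval: "is_interval I" and nontrivial: "\<exists>a\<in>I. \<exists>b\<in>I. a < b"
    and flow: "normalized_gauss_flow I u"
    and body: "t \<in> I \<Longrightarrow> convex_body (\<Omega> t)"
    and supp: "t \<in> I \<Longrightarrow> x \<in> sphere 0 1 \<Longrightarrow> u x t = support_fun (\<Omega> t) 0 x"

sublocale gauss_flow \<subseteq> smooth_family u I
  using flow by unfold_locales (simp add: normalized_gauss_flow_def)

context gauss_flow
begin

abbreviation normal_map :: "real^'n \<Rightarrow> real \<Rightarrow> real^'n" where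
  "normal_map x t \<equiv> smooth_body.touch (\<lambda>y. u y t) x"

definition K :: "real^'n \<Rightarrow> real \<Rightarrow> real" where
  "K x t = 1 / tan_det x (hess_plus (\<lambda>y. u y t) x)"

text \<open>The support function of \<open>exp (- t)\<close> times \<open>\<Omega> t\<close>. These
  bodies evolve by the unnormalised Gauss curvature flow after a change of time.\<close>

definition w :: "real^'n \<Rightarrow> real \<Rightarrow> real" where
  "w x t = exp (- t) * u x t"

lemma slice_body: "t \<in> I \<Longrightarrow> smooth_body (\<Omega> t) (\<lambda>y. u y t)"
  using flow body supp differentiable_slice
  by unfold_locales (auto simp: normalized_gauss_flow_def)

lemma normal_map_eq:
  "t \<in> I \<Longrightarrow> normal_map x t = u x t *\<^sub>R x + sphere_grad (\<lambda>y. u y t) x"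
  using smooth_body.touch_def[OF slice_body] .

lemma K_pos: "norm x = 1 \<Longrightarrow> t \<in> I \<Longrightarrow> K x t > 0"
  using smooth_body.tan_det_hess_pos[OF slice_body] by (simp add: K_def)

lemma derivative_u:
  "norm x = 1 \<Longrightarrow> t \<in> I \<Longrightarrow> ((\<lambda>s. u x s) has_real_derivative u x t - K x t) (at t within I)"
  using flow by (simp add: normalized_gauss_flow_def K_def)

lemma derivative_w:
  assumes "norm x = 1" "t \<in> I"
  shows "((\<lambda>s. w x s) has_real_derivative - (exp (- t) * K x t)) (at t within I)"
  unfolding w_def using derivative_u[OF assms]
  by (auto intro!: derivative_eq_intros simp: algebra_simps)

lemma Icc_subset: "a \<in> I \<Longrightarrow> b \<in> I \<Longrightarrow> {a..b} \<subseteq> I"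
  using interval by (meson atLeastAtMost_iff is_interval_1 subsetI)

lemma Ioo_subset: "a \<in> I \<Longrightarrow> b \<in> I \<Longrightarrow> {a<..<b} \<subseteq> interior I"
  using Icc_subset[of a b] by (intro interior_maximal) auto

lemma limpt_time: "t \<in> I \<Longrightarrow> at t within I \<noteq> bot"
proof -
  assume t: "t \<in> I"
  have "connected I" using interval by (simp add: is_interval_connected_1)
  then have "t islimpt I"
    using t nontrivial by (intro connected_imp_perfect) auto
  then show ?thesis by (simp add: trivial_limit_within)
qed

text \<open>The flow equation gives \<open>K\<close> as \<open>u\<close> minus its time derivative,
  so joint continuity follows without touching the determinant of the Hessian.\<close>

lemma continuous_on_K: "continuous_on (sphere 0 1 \<times> I) (\<lambda>(x, t). K x t)"
proof -
  have "continuous_on (sphere 0 1 \<times> I) (\<lambda>(x, t). u x t - K x t)"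
    using limpt_time derivative_u by (intro continuous_on_time_derivative) auto
  from continuous_on_diff[OF continuous_on_family this] show ?thesis
    by (simp add: case_prod_unfold)
qed

lemma continuous_on_w: "norm x = 1 \<Longrightarrow> continuous_on I (\<lambda>t. w x t)"
  using derivative_w by (intro DERIV_continuous_on) auto

lemma w_decreasing:
  assumes x: "norm x = 1" and "a \<in> I" "b \<in> I" "a < b"
  shows "w x b < w x a"
proof (rule DERIV_neg_imp_decreasing_open[OF \<open>a < b\<close>])
  fix s assume "a < s" "s < b"
  then have s: "s \<in> interior I" using Ioo_subset[of a b] assms by auto
  then have sI: "s \<in> I" using interior_subset by blast
  have "((\<lambda>s. w x s) has_real_derivative - (exp (- s) * K x s)) (at s)"
    using derivative_w[OF x sI] at_within_interior[OF s] by simp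
  moreover have "- (exp (- s) * K x s) < 0" using K_pos[OF x sI] by simp
  ultimately show "\<exists>y. ((\<lambda>s. w x s) has_real_derivative y) (at s) \<and> y < 0" by blast
next
  show "continuous_on {a..b} (\<lambda>s. w x s)"
    using continuous_on_subset[OF continuous_on_w[OF x] Icc_subset] assms by blast
qed

lemma mem_scaled_iff:
  assumes "t \<in> I"
  shows "p \<in> (*\<^sub>R) (exp (- t)) ` \<Omega> t \<longleftrightarrow> (\<forall>x. norm x = 1 \<longrightarrow> x \<bullet> p \<le> w x t)"
    and "p \<in> (*\<^sub>R) (exp (- t)) ` interior (\<Omega> t) \<longleftrightarrow> (\<forall>x. norm x = 1 \<longrightarrow> x \<bullet> p < w x t)"
proof -
  interpret B: smooth_body "\<Omega> t" "\<lambda>y. u y t" by (rule slice_body[OF assms])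
  have *: "p \<in> (*\<^sub>R) (exp (- t)) ` S \<longleftrightarrow> exp t *\<^sub>R p \<in> S" for S :: "(real^'n) set"
    by (auto simp: image_iff exp_minus intro!: bexI[of _ "exp t *\<^sub>R p"])
  have e: "exp t * a \<le> b \<longleftrightarrow> a \<le> exp (- t) * b" "exp t * a < b \<longleftrightarrow> a < exp (- t) * b" for a b :: real
    by (simp_all add: exp_minus field_simps)
  show "p \<in> (*\<^sub>R) (exp (- t)) ` \<Omega> t \<longleftrightarrow> (\<forall>x. norm x = 1 \<longrightarrow> x \<bullet> p \<le> w x t)"
    unfolding * B.mem_iff by (simp add: w_def e)
  show "p \<in> (*\<^sub>R) (exp (- t)) ` interior (\<Omega> t) \<longleftrightarrow> (\<forall>x. norm x = 1 \<longrightarrow> x \<bullet> p < w x t)"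
    unfolding * B.interior_iff by (simp add: w_def e)
qed

text \<open>The sphere of radius \<open>exp (- t)\<close> is sent to the boundary of
  \<open>exp (- t)\<close> times \<open>\<Omega> t\<close>, so larger radii belong to earlier
  times.\<close>

definition shell_map :: "real^'n \<Rightarrow> real^'n" where
  "shell_map y = norm y *\<^sub>R normal_map (sgn y) (- ln (norm y))"

text \<open>The radial speed of the shell map is \<open>K\<close> and its tangential part is the inverse of the
  Weingarten map, so that it preserves volume.\<close>

lemma shell_map_derivative:
  assumes y: "y \<noteq> 0" and \<tau>: "- ln (norm y) \<in> interior I"
  shows "\<exists>f'. (shell_map has_derivative f') (at y) \<and> det (matrix f') = 1"
proof -
  define x t r where "x = sgn y" and "t = - ln (norm y)" and "r = norm y"
  have x: "norm x = 1" and r: "r > 0" and yx: "y /\<^sub>R r = x"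
    using y by (simp_all add: x_def r_def norm_sgn sgn_div_norm)
  have t: "t \<in> interior I" "t \<in> I" using \<tau> interior_subset by (auto simp: t_def)
  have x0: "x \<noteq> 0" using x by auto
  interpret B: smooth_body "\<Omega> t" "\<lambda>y. u y t" by (rule slice_body[OF t(2)])
  let ?A = "\<lambda>v. hess_plus (\<lambda>y. u y t) x (tan_proj x v)"
  define Q where "Q = (\<lambda>(y, s). u (sgn y) s *\<^sub>R sgn y + sphere_grad (\<lambda>z. u z s) (sgn y))"
  have Q_eq: "Q (y, s) = normal_map (sgn y) s" if "s \<in> I" for y s
    using normal_map_eq[OF that] by (simp add: Q_def)
  have "((\<lambda>p::(real^'n) \<times> real. sgn (fst p)) has_derivative (\<lambda>p. tan_proj x (fst p))) (at (x, t))"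
    by (rule has_derivative_compose[OF has_derivative_fst[OF has_derivative_ident]])
      (use has_derivative_sgn[OF x0] x in \<open>simp add: sgn_unit\<close>)
  then have "(\<lambda>p::(real^'n) \<times> real. sgn (fst p)) differentiable (at (x, t))"
    by (rule differentiableI)
  then have "Q differentiable (at (x, t))"
    using differentiable_interior[OF x t(1)] unfolding Q_def case_prod_unfold
    by (intro differentiable_add differentiable_scaleR)
  then obtain L where L: "(Q has_derivative L) (at (x, t))"
    unfolding differentiable_def by blast
  have linL: "linear L" using L by (rule has_derivative_linear)
  have L1: "L (v, 0) = ?A v" for v
  proof -
    have "((\<lambda>y. (y, t)) has_derivative (\<lambda>v. (v, 0))) (at x)"
      by (intro has_derivative_Pair) auto
    from has_derivative_compose[OF this L]
    have "((\<lambda>y. normal_map (sgn y) t) has_derivative (\<lambda>v. L (v, 0))) (at x)"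
      by (simp add: Q_eq[OF t(2)])
    then have "(\<lambda>v. L (v, 0)) = ?A"
      using B.has_derivative_touch(1)[OF x] by (rule has_derivative_unique)
    then show ?thesis by (simp add: fun_eq_iff)
  qed
  \<comment> \<open>Of the time derivative of the boundary point, the determinant sees the normal
    component only; \<open>x \<bullet> Q (x, s) = u x s\<close> identifies it with the time
    derivative of \<open>u\<close>.\<close>
  have L2: "x \<bullet> L (0, 1) = u x t - K x t"
  proof -
    have "((\<lambda>s. (x, s)) has_derivative (\<lambda>s. (0, s))) (at t)"
      by (intro has_derivative_Pair) auto
    from has_derivative_inner_right[OF has_derivative_compose[OF this L]]
    have "((\<lambda>s. x \<bullet> Q (x, s)) has_derivative (\<lambda>s. x \<bullet> L (0, s))) (at t)" .
    then have "((\<lambda>s. u x s) has_derivative (\<lambda>s. x \<bullet> L (0, s))) (at t)"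
    proof (rule has_derivative_transform_within_open)
      fix s assume "s \<in> interior I"
      then have s: "s \<in> I" using interior_subset by blast
      show "x \<bullet> Q (x, s) = u x s"
        using smooth_body.inner_touch[OF slice_body[OF s] x] x by (simp add: Q_eq[OF s] sgn_unit)
    qed (use t in auto)
    moreover have "((\<lambda>s. u x s) has_derivative (\<lambda>s. (u x t - K x t) * s)) (at t)"
      using derivative_u[OF x t(2)] at_within_interior[OF t(1)] by (simp add: has_field_derivative_def)
    ultimately have "(\<lambda>s. x \<bullet> L (0, s)) = (\<lambda>s. (u x t - K x t) * s)"
      by (rule has_derivative_unique)
    from fun_cong[OF this, of 1] show ?thesis by simp
  qed
  \<comment> \<open>\<open>Q\<close> depends on the direction of its first argument only. Dividing
    by the fixed number \<open>r\<close> instead of \<open>norm z\<close> puts the base point at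
    \<open>(x, t)\<close> without changing the value.\<close>
  have "((\<lambda>z. (z /\<^sub>R r, - ln (norm z))) has_derivative (\<lambda>v. (v /\<^sub>R r, - (x \<bullet> v) / r))) (at y)"
    using y r by (auto intro!: derivative_eq_intros has_derivative_norm[OF y]
        simp: x_def r_def inner_commute divide_inverse)
  from has_derivative_compose[OF this, of Q L] L
  have "((\<lambda>z. Q (z /\<^sub>R r, - ln (norm z))) has_derivative (\<lambda>v. L (v /\<^sub>R r, - (x \<bullet> v) / r))) (at y)"
    by (simp add: yx t_def)
  from has_derivative_scaleR[OF has_derivative_norm[OF y] this]
  have D: "((\<lambda>z. norm z *\<^sub>R Q (z /\<^sub>R r, - ln (norm z))) has_derivative
    (\<lambda>v. norm y *\<^sub>R L (v /\<^sub>R r, - (x \<bullet> v) / r) + (v \<bullet> sgn y) *\<^sub>R Q (y /\<^sub>R r, - ln (norm y)))) (at y)" .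
  have "norm y *\<^sub>R L (v /\<^sub>R r, - (x \<bullet> v) / r) + (v \<bullet> sgn y) *\<^sub>R Q (y /\<^sub>R r, - ln (norm y))
    = ?A v + (x \<bullet> v) *\<^sub>R (normal_map x t - L (0, 1))" for v
  proof -
    have "L (v /\<^sub>R r, - (x \<bullet> v) / r) = L ((1 / r) *\<^sub>R ((v, 0) - (x \<bullet> v) *\<^sub>R (0, 1)))"
      by (simp add: divide_inverse mult.commute)
    also have "\<dots> = (1 / r) *\<^sub>R (?A v - (x \<bullet> v) *\<^sub>R L (0, 1))"
      by (simp only: linear_scale[OF linL] linear_diff[OF linL] L1)
    finally have "norm y *\<^sub>R L (v /\<^sub>R r, - (x \<bullet> v) / r) = ?A v - (x \<bullet> v) *\<^sub>R L (0, 1)"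
      using r by (simp add: r_def)
    moreover have "Q (y /\<^sub>R r, - ln (norm y)) = normal_map x t"
      using Q_eq[OF t(2), of x] x by (simp add: yx t_def sgn_unit)
    ultimately show ?thesis
      by (simp add: x_def inner_commute scaleR_right_diff_distrib)
  qed
  then have D': "((\<lambda>z. norm z *\<^sub>R Q (z /\<^sub>R r, - ln (norm z))) has_derivative
    (\<lambda>v. ?A v + (x \<bullet> v) *\<^sub>R (normal_map x t - L (0, 1)))) (at y)"
    using D by (simp only:)
  have "open ((- {0}) \<inter> (\<lambda>z. - ln (norm z)) -` interior I)"
    by (rule continuous_open_preimage) (auto intro!: continuous_intros)
  then have "(shell_map has_derivative (\<lambda>v. ?A v + (x \<bullet> v) *\<^sub>R (normal_map x t - L (0, 1)))) (at y)"
  proof (rule has_derivative_transform_within_open[OF D'])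
    show "y \<in> - {0} \<inter> (\<lambda>z. - ln (norm z)) -` interior I" using y t by (simp add: t_def)
    fix z assume "z \<in> - {0} \<inter> (\<lambda>z::real^'n. - ln (norm z)) -` interior I"
    then have "- ln (norm z) \<in> I" using interior_subset by auto
    from Q_eq[OF this, of "z /\<^sub>R r"] show "norm z *\<^sub>R Q (z /\<^sub>R r, - ln (norm z)) = shell_map z"
      using r by (simp add: shell_map_def sgn_scaleR)
  qed
  \<comment> \<open>The image of the normal has normal component
    \<open>u x t - (u x t - K x t) = K x t\<close>, the reciprocal of the tangential
    determinant.\<close>
  moreover have "det (matrix (\<lambda>v. ?A v + (x \<bullet> v) *\<^sub>R (normal_map x t - L (0, 1)))) = 1"
    using K_pos[OF x t(2)]
    by (subst det_tan_extension[OF x B.linear_hess[OF x] B.has_derivative_touch(2)[OF x]])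
      (simp add: inner_diff_right B.inner_touch[OF x] L2 K_def)
  ultimately show ?thesis by blast
qed

lemma inner_shell_map:
  assumes "y \<noteq> 0" and t: "- ln (norm y) \<in> I"
  shows "sgn y \<bullet> shell_map y = w (sgn y) (- ln (norm y))"
    and "norm x = 1 \<Longrightarrow> x \<bullet> shell_map y \<le> w x (- ln (norm y))"
proof -
  interpret B: smooth_body "\<Omega> (- ln (norm y))" "\<lambda>z. u z (- ln (norm y))"
    by (rule slice_body[OF t])
  have y: "norm (sgn y) = 1" "exp (- (- ln (norm y))) = norm y"
    using assms by (simp_all add: norm_sgn)
  show "sgn y \<bullet> shell_map y = w (sgn y) (- ln (norm y))"
    using B.inner_touch[OF y(1)] by (simp add: shell_map_def w_def y(2) del: minus_minus)
  show "x \<bullet> shell_map y \<le> w x (- ln (norm y))" if x: "norm x = 1"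
    using B.inner_le_h[OF x B.touch_in[OF y(1)]]
    by (simp add: shell_map_def w_def y(2) mult_left_mono del: minus_minus)
qed

section \<open>The annulus and the region between two nested scaled bodies\<close>

context
  fixes a b assumes ab: "a \<in> I" "b \<in> I" "a < b"
begin

definition "shell = {y::real^'n. exp (- b) < norm y \<and> norm y < exp (- a)}"

lemma shell_time:
  assumes "y \<in> shell"
  shows "y \<noteq> 0" "a < - ln (norm y)" "- ln (norm y) < b"
    "- ln (norm y) \<in> interior I" "- ln (norm y) \<in> I"
proof -
  have 1: "exp (- b) < norm y" "norm y < exp (- a)" using assms by (auto simp: shell_def)
  have n: "norm y > 0" using 1(1) exp_gt_zero[of "- b"] by linarith
  then show "y \<noteq> 0" by simp
  have "- b < ln (norm y)" using 1(1) n by (metis exp_less_cancel_iff exp_ln)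
  moreover have "ln (norm y) < - a" using 1(2) n by (metis exp_less_cancel_iff exp_ln)
  ultimately show 2: "a < - ln (norm y)" "- ln (norm y) < b" by simp_all
  then show "- ln (norm y) \<in> interior I" using Ioo_subset[OF ab(1,2)] by auto
  then show "- ln (norm y) \<in> I" using interior_subset by blast
qed

text \<open>If two points of different radius had the same image, \<open>w\<close> in the normal
  direction at the earlier time could not exceed its value at the later one, against strict
  decrease. At equal radii the normal is unique by \<open>inj_touch\<close>.\<close>

lemma inj_on_shell_map: "inj_on shell_map shell"
proof (rule inj_onI)
  have le: "\<not> - ln (norm y) < - ln (norm z)"
    if y: "y \<in> shell" and z: "z \<in> shell" and eq: "shell_map y = shell_map z" for y z
  proof
    assume less: "- ln (norm y) < - ln (norm z)"
    have n: "norm (sgn y) = 1" using shell_time[OF y] by (simp add: norm_sgn)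
    have "w (sgn y) (- ln (norm y)) \<le> w (sgn y) (- ln (norm z))"
      using inner_shell_map(1)[OF shell_time(1,5)[OF y]]
        inner_shell_map(2)[OF shell_time(1,5)[OF z] n] eq by simp
    then show False
      using w_decreasing[OF n shell_time(5)[OF y] shell_time(5)[OF z] less] by simp
  qed
  fix y z assume y: "y \<in> shell" and z: "z \<in> shell" and eq: "shell_map y = shell_map z"
  have "- ln (norm y) = - ln (norm z)" using le[OF y z eq] le[OF z y eq[symmetric]] by linarith
  then have n: "norm y = norm z" using shell_time(1)[OF y] shell_time(1)[OF z] by simp
  interpret B: smooth_body "\<Omega> (- ln (norm y))" "\<lambda>x. u x (- ln (norm y))"
    by (rule slice_body[OF shell_time(5)[OF y]])
  have "B.touch (sgn y) = B.touch (sgn z)"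
    using eq n shell_time(1)[OF y] shell_time(1)[OF z] by (simp add: shell_map_def)
  moreover have "norm (sgn y) = 1" "norm (sgn z) = 1"
    using shell_time(1)[OF y] shell_time(1)[OF z] by (simp_all add: norm_sgn)
  ultimately have "sgn y = sgn z" by (rule B.inj_touch[rotated 2])
  then have "norm y *\<^sub>R sgn y = norm z *\<^sub>R sgn z" using n by simp
  then show "y = z" using shell_time(1)[OF y] shell_time(1)[OF z] by (simp add: sgn_div_norm)
qed

text \<open>\<open>t\<close> is the last time up to which the shrinking body still contains
  \<open>p\<close>. Without contact at \<open>t\<close>, compactness of the sphere would leave a
  positive margin \<open>m\<close>, and uniform continuity would keep \<open>p\<close> inside a
  little longer.\<close>

lemma first_contact:
  assumes p: "\<And>x. norm x = 1 \<Longrightarrow> x \<bullet> p < w x a" and q: "norm q = 1" "w q b < q \<bullet> p"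
  shows "\<exists>t x. a < t \<and> t < b \<and> norm x = 1 \<and> x \<bullet> p = w x t \<and> (\<forall>y. norm y = 1 \<longrightarrow> y \<bullet> p \<le> w y t)"
proof -
  have sub: "{a..b} \<subseteq> I" using Icc_subset[OF ab(1,2)] .
  let ?S = "{t\<in>{a..b}. \<forall>x. norm x = 1 \<longrightarrow> x \<bullet> p \<le> w x t}"
  have "closed {t\<in>{a..b}. x \<bullet> p \<le> w x t}" if "norm x = 1" for x
    using continuous_on_subset[OF continuous_on_w[OF that] sub]
    by (intro continuous_on_closed_Collect_le continuous_on_const) auto
  then have "closed (\<Inter>x\<in>{x. norm x = 1}. {t\<in>{a..b}. x \<bullet> p \<le> w x t})"
    by (intro closed_INT) auto
  also have "(\<Inter>x\<in>{x. norm x = 1}. {t\<in>{a..b}. x \<bullet> p \<le> w x t}) = ?S"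
    using q(1) by auto
  finally have closed: "closed ?S" .
  have aS: "a \<in> ?S" using p ab by (auto simp: less_imp_le)
  have bdd: "bdd_above ?S" by (rule bdd_aboveI[of _ b]) auto
  define t where "t = Sup ?S"
  have tS: "t \<in> ?S"
    unfolding t_def using aS bdd closed by (intro closed_contains_Sup) auto
  have max: "s \<le> t" if "s \<in> ?S" for s
    unfolding t_def using that bdd by (rule cSup_upper)
  have "t \<noteq> b" using tS q by force
  then have tb: "t < b" using tS by auto
  have "\<exists>x. norm x = 1 \<and> x \<bullet> p = w x t"
  proof (rule ccontr)
    assume "\<not> ?thesis"
    then have strict: "x \<bullet> p < w x t" if "norm x = 1" for x
      using that tS by (metis (mono_tags, lifting) mem_Collect_eq order_le_less)
    let ?\<phi> = "\<lambda>(x, s). w x s - x \<bullet> p"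
    have cont: "continuous_on (sphere 0 1 \<times> {a..b}) ?\<phi>"
    proof -
      have "continuous_on (sphere 0 1 \<times> {a..b}) (\<lambda>(x, s). u x s)"
        by (rule continuous_on_subset[OF continuous_on_family]) (use sub in auto)
      then show ?thesis
        unfolding w_def case_prod_unfold by (intro continuous_intros)
    qed
    have tab: "t \<in> {a..b}" using tS by auto
    have "continuous_on (sphere 0 1) (\<lambda>x. w x t - x \<bullet> p)"
    proof -
      have "continuous_on (sphere 0 1) (\<lambda>x. ?\<phi> (x, t))"
        by (rule continuous_on_compose2[OF cont]) (use tab in \<open>auto intro!: continuous_intros\<close>)
      then show ?thesis by simp
    qed
    moreover have "q \<in> sphere 0 1" using q by simp
    ultimately obtain x0 where x0: "norm x0 = 1" "\<And>x. norm x = 1 \<Longrightarrow> w x0 t - x0 \<bullet> p \<le> w x t - x \<bullet> p"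
      using continuous_attains_inf[OF compact_sphere, of 0 1 "\<lambda>x. w x t - x \<bullet> p"] by auto
    define m where "m = w x0 t - x0 \<bullet> p"
    have m: "m > 0" using strict[OF x0(1)] by (simp add: m_def)
    have "uniformly_continuous_on (sphere 0 1 \<times> {a..b}) ?\<phi>"
      by (intro compact_uniformly_continuous cont compact_Times) auto
    then obtain d where d: "d > 0"
      "\<And>p q. p \<in> sphere 0 1 \<times> {a..b} \<Longrightarrow> q \<in> sphere 0 1 \<times> {a..b} \<Longrightarrow> dist q p < d \<Longrightarrow> dist (?\<phi> q) (?\<phi> p) < m"
      unfolding uniformly_continuous_on_def using m by meson
    \<comment> \<open>A time later than \<open>t\<close>, capped at \<open>b\<close> and within the
      modulus of continuity \<open>d\<close>; it would contradict the choice of \<open>t\<close> as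
      a supremum.\<close>
    define s where "s = min b (t + d / 2)"
    have s: "t < s" "s \<in> {a..b}" "dist s t < d"
      using tb d(1) tab by (auto simp: s_def dist_real_def)
    have "x \<bullet> p \<le> w x s" if x: "norm x = 1" for x
    proof -
      have "dist (?\<phi> (x, s)) (?\<phi> (x, t)) < m"
        using x s tab by (intro d(2)) (auto simp: dist_Pair_Pair)
      then have "\<bar>(w x s - x \<bullet> p) - (w x t - x \<bullet> p)\<bar> < m" by (simp add: dist_real_def)
      then show ?thesis using x0(2)[OF x] by (simp add: m_def)
    qed
    then have "s \<in> ?S" using s by auto
    then show False using max s by fastforce
  qed
  then obtain x where x: "norm x = 1" "x \<bullet> p = w x t" by blast
  then have "t \<noteq> a" using p[OF x(1)] by auto
  then have "a < t" using tS by auto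
  then show ?thesis using tb x tS by auto
qed

lemma shell_map_image:
  "shell_map ` shell = (*\<^sub>R) (exp (- a)) ` interior (\<Omega> a) - (*\<^sub>R) (exp (- b)) ` \<Omega> b"
proof (intro equalityI subsetI)
  fix p assume "p \<in> shell_map ` shell"
  then obtain y where y: "y \<in> shell" "p = shell_map y" by blast
  note ty = shell_time[OF y(1)]
  have "x \<bullet> p < w x a" if x: "norm x = 1" for x
    using inner_shell_map(2)[OF ty(1,5) x] w_decreasing[OF x ab(1) ty(5,2)] y(2) by simp
  moreover have n: "norm (sgn y) = 1" using ty(1) by (simp add: norm_sgn)
  then have "w (sgn y) b < sgn y \<bullet> p"
    using inner_shell_map(1)[OF ty(1,5)] w_decreasing[OF n ty(5) ab(2) ty(3)] y(2) by simp
  ultimately show "p \<in> (*\<^sub>R) (exp (- a)) ` interior (\<Omega> a) - (*\<^sub>R) (exp (- b)) ` \<Omega> b"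
    unfolding Diff_iff mem_scaled_iff[OF ab(1)] mem_scaled_iff[OF ab(2)] using n by (metis not_less)
next
  fix p assume "p \<in> (*\<^sub>R) (exp (- a)) ` interior (\<Omega> a) - (*\<^sub>R) (exp (- b)) ` \<Omega> b"
  then have p: "\<And>x. norm x = 1 \<Longrightarrow> x \<bullet> p < w x a" and "\<exists>q. norm q = 1 \<and> w q b < q \<bullet> p"
    unfolding Diff_iff mem_scaled_iff[OF ab(1)] mem_scaled_iff[OF ab(2)] by (auto simp: not_le)
  then obtain q where q: "norm q = 1" "w q b < q \<bullet> p" by blast
  obtain t x where t: "a < t" "t < b" and x: "norm x = 1" "x \<bullet> p = w x t"
    and le: "\<forall>y. norm y = 1 \<longrightarrow> y \<bullet> p \<le> w y t"
    using first_contact[OF p q] by blast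
  have tI: "t \<in> I" using t Icc_subset[OF ab(1,2)] by auto
  interpret B: smooth_body "\<Omega> t" "\<lambda>y. u y t" by (rule slice_body[OF tI])
  have e: "exp t * (exp (- t) * c) = c" for c :: real by (simp add: exp_minus)
  have "exp t *\<^sub>R p \<in> \<Omega> t"
    unfolding B.mem_iff
  proof (intro allI impI)
    fix y :: "real^'n" assume "norm y = 1"
    then have "exp t * (y \<bullet> p) \<le> exp t * w y t" using le by simp
    then show "y \<bullet> exp t *\<^sub>R p \<le> u y t" by (simp add: w_def e)
  qed
  moreover have "x \<bullet> exp t *\<^sub>R p = u x t" using x(2) by (simp add: w_def e)
  ultimately have "exp t *\<^sub>R p = B.touch x" by (rule B.touch_unique[OF x(1)])
  then have "exp (- t) *\<^sub>R exp t *\<^sub>R p = exp (- t) *\<^sub>R B.touch x" by simp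
  then have "p = exp (- t) *\<^sub>R B.touch x" by (simp add: exp_minus)
  moreover have "norm (exp (- t) *\<^sub>R x) = exp (- t)" "sgn (exp (- t) *\<^sub>R x) = x"
    using x(1) by (simp_all add: sgn_scaleR sgn_unit)
  ultimately have "shell_map (exp (- t) *\<^sub>R x) = p" "exp (- t) *\<^sub>R x \<in> shell"
    using t by (simp_all add: shell_map_def shell_def)
  then show "p \<in> shell_map ` shell" by blast
qed

text \<open>Since the shell map has Jacobian 1, the annulus and its image have equal volume. The
  image is a difference of nested sets, and passing from the interior of \<open>\<Omega> a\<close>
  to \<open>\<Omega> a\<close> is free because a convex set has negligible boundary.\<close>

lemma measure_shell:
  "exp (- a) ^ CARD('n) * measure lborel (\<Omega> a) - exp (- b) ^ CARD('n) * measure lborel (\<Omega> b)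
    = (exp (- a) ^ CARD('n) - exp (- b) ^ CARD('n)) * measure lborel (cball (0::real^'n) 1)"
proof -
  interpret A: smooth_body "\<Omega> a" "\<lambda>y. u y a" by (rule slice_body[OF ab(1)])
  interpret B: smooth_body "\<Omega> b" "\<lambda>y. u y b" by (rule slice_body[OF ab(2)])
  let ?E = "(*\<^sub>R) (exp (- a)) ` interior (\<Omega> a)" and ?F = "(*\<^sub>R) (exp (- b)) ` \<Omega> b"
  have E: "open ?E" by (intro open_scaling) auto
  have F: "compact ?F" by (rule compact_scaling[OF B.compact])
  have FE: "?F \<subseteq> ?E"
  proof
    fix p assume "p \<in> ?F"
    then show "p \<in> ?E"
      unfolding mem_scaled_iff[OF ab(1)] mem_scaled_iff[OF ab(2)]
      using w_decreasing[OF _ ab] by (meson le_less_trans)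
  qed
  have scale: "measure lborel ((*\<^sub>R) (exp c) ` S) = exp c ^ CARD('n) * measure lborel S"
    if "S \<in> sets borel" "(*\<^sub>R) (exp c) ` S \<in> sets borel" for c and S :: "(real^'n) set"
    using measure_lebesgue_affine[of "exp c" "0::real^'n" S] that by simp
  have sub: "?E \<subseteq> (*\<^sub>R) (exp (- a)) ` \<Omega> a" using interior_subset by blast
  have "emeasure lborel ?E \<le> emeasure lborel ((*\<^sub>R) (exp (- a)) ` \<Omega> a)"
    using sub compact_scaling[OF A.compact] by (intro emeasure_mono) (auto simp: borel_compact)
  then have fin: "emeasure lborel ?E \<noteq> \<infinity>"
    using emeasure_compact_finite[OF compact_scaling[OF A.compact, of "exp (- a)"]]
    by (auto simp: top_unique)
  have shell_eq: "shell = ball 0 (exp (- a)) - cball 0 (exp (- b))"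
    by (auto simp: shell_def)
  have ms: "measure lborel shell = (exp (- a) ^ CARD('n) - exp (- b) ^ CARD('n)) * measure lborel (cball (0::real^'n) 1)"
  proof -
    have "measure lborel shell = measure lborel (ball (0::real^'n) (exp (- a))) - measure lborel (cball (0::real^'n) (exp (- b)))"
      unfolding shell_eq using ab emeasure_lborel_ball_finite[of "0::real^'n" "exp (- a)"]
        le_less_trans[of _ "exp (- b)" "exp (- a)"]
      by (intro measure_Diff) auto
    then show ?thesis
      by (simp add: content_ball content_cball algebra_simps)
  qed
  have "\<forall>y\<in>shell. \<exists>f'. (shell_map has_derivative f') (at y) \<and> det (matrix f') = 1"
    using shell_map_derivative shell_time(1,4) by blast
  then obtain f' where f': "\<And>y. y \<in> shell \<Longrightarrow> (shell_map has_derivative f' y) (at y)"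
    "\<And>y. y \<in> shell \<Longrightarrow> det (matrix (f' y)) = 1"
    by metis
  have shell_sets: "shell \<in> sets borel" unfolding shell_eq by auto
  have shell_fin: "emeasure lborel shell < \<infinity>"
    using emeasure_lborel_ball_finite[of "0::real^'n" "exp (- a)"]
    by (rule le_less_trans[rotated]) (auto intro!: emeasure_mono simp: shell_eq)
  have "measure lborel (shell_map ` shell) = (LINT y:shell|lborel. 1)"
  proof (rule measure_injective_image[OF shell_sets _ f'(1) inj_on_shell_map])
    show "shell_map ` shell \<in> sets borel"
      unfolding shell_map_image using E F by (auto simp: borel_compact)
    show "set_integrable lborel shell (\<lambda>y. 1::real)"
      using shell_sets shell_fin by (simp add: set_integrable_def)
  qed (simp_all add: f'(2))
  also have "\<dots> = measure lborel shell"
    using shell_sets by (simp add: set_lebesgue_integral_def)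
  also have "measure lborel (shell_map ` shell) = measure lborel ?E - measure lborel ?F"
    unfolding shell_map_image using E F FE fin by (intro measure_Diff) (auto simp: borel_compact)
  also have "measure lborel ?E = exp (- a) ^ CARD('n) * measure lborel (interior (\<Omega> a))"
    using E by (intro scale) auto
  also have "measure lborel (interior (\<Omega> a)) = measure lborel (\<Omega> a)"
  proof -
    have "measure lebesgue (interior (\<Omega> a)) = measure lebesgue (\<Omega> a)"
      using A.compact A.convex by (intro measure_interior negligible_convex_frontier compact_imp_bounded)
    then show ?thesis using A.compact by (simp add: borel_compact)
  qed
  also have "measure lborel ?F = exp (- b) ^ CARD('n) * measure lborel (\<Omega> b)"
    using F B.compact by (intro scale) (auto simp: borel_compact)
  finally show ?thesis unfolding ms .
qed

end

lemma volume_preserved: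
  assumes s: "s \<in> I" and V: "measure lborel (\<Omega> s) = measure lborel (cball (0::real^'n) 1)" and t: "t \<in> I"
  shows "measure lborel (\<Omega> t) = measure lborel (cball (0::real^'n) 1)"
proof -
  have *: "exp (- a) ^ CARD('n) * (measure lborel (\<Omega> a) - measure lborel (cball (0::real^'n) 1))
    = exp (- b) ^ CARD('n) * (measure lborel (\<Omega> b) - measure lborel (cball (0::real^'n) 1))"
    if "a \<in> I" "b \<in> I" "a < b" for a b
    using measure_shell[OF that] by (simp add: algebra_simps)
  show ?thesis
    using *[OF s t] *[OF t s] V by (cases s t rule: linorder_cases) auto
qed

end

section \<open>Monotonicity of the entropy\<close>

lemma sphere_mean_abs_le:
  fixes f :: "real^'n \<Rightarrow> real"
  assumes f: "continuous_on (sphere 0 1) f" and le: "\<And>x. norm x = 1 \<Longrightarrow> \<bar>f x\<bar> \<le> B"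
  shows "\<bar>sphere_mean f\<bar> \<le> B"
proof -
  have "sphere_mean f \<le> B"
    using sphere_mean_mono[OF f continuous_on_const[of _ B]] le sphere_mean_const[where 'n = 'n]
    by (metis abs_le_D1)
  moreover have "- B \<le> sphere_mean f"
    using sphere_mean_mono[OF continuous_on_const[of _ "- B"] f] le sphere_mean_const[where 'n = 'n]
    by (metis abs_le_iff minus_le_iff)
  ultimately show ?thesis by simp
qed

lemma uniform_in_space:
  fixes F :: "'a::metric_space \<Rightarrow> real \<Rightarrow> real"
  assumes "continuous_on (S \<times> T) (\<lambda>(x, t). F x t)" "compact S" "compact T" "e > 0"
  obtains d where "d > 0" "\<And>x s t. x \<in> S \<Longrightarrow> s \<in> T \<Longrightarrow> t \<in> T \<Longrightarrow> \<bar>s - t\<bar> < d \<Longrightarrow> \<bar>F x s - F x t\<bar> < e"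
proof -
  have "uniformly_continuous_on (S \<times> T) (\<lambda>(x, t). F x t)"
    using assms by (intro compact_uniformly_continuous compact_Times)
  then obtain d where d: "d > 0" "\<And>p q. p \<in> S \<times> T \<Longrightarrow> q \<in> S \<times> T \<Longrightarrow> dist q p < d \<Longrightarrow>
      dist (case q of (x, t) \<Rightarrow> F x t) (case p of (x, t) \<Rightarrow> F x t) < e"
    unfolding uniformly_continuous_on_def using assms(4) by meson
  have "\<bar>F x s - F x t\<bar> < e" if "x \<in> S" "s \<in> T" "t \<in> T" "\<bar>s - t\<bar> < d" for x s t
    using d(2)[of "(x, t)" "(x, s)"] that by (simp add: dist_Pair_Pair dist_real_def)
  with d(1) show thesis by (rule that)
qed

lemma continuous_on_slice:
  assumes "continuous_on (S \<times> T) (\<lambda>(x, t). F x t)" "t \<in> T"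
  shows "continuous_on S (\<lambda>x. F x t)"
proof -
  have "continuous_on S (\<lambda>x. (\<lambda>(x, t). F x t) (x, t))"
    by (rule continuous_on_compose2[OF assms(1)]) (use assms(2) in \<open>auto intro!: continuous_intros\<close>)
  then show ?thesis by simp
qed

lemma continuous_on_sphere_mean:
  fixes F :: "real^'n \<Rightarrow> real \<Rightarrow> real"
  assumes F: "continuous_on (sphere 0 1 \<times> {a..b}) (\<lambda>(x, t). F x t)"
  shows "continuous_on {a..b} (\<lambda>t. sphere_mean (\<lambda>x. F x t))"
  unfolding continuous_on_iff
proof (intro ballI allI impI)
  fix t and e :: real assume t: "t \<in> {a..b}" and e: "e > 0"
  obtain d where d: "d > 0" "\<And>x s t. x \<in> sphere 0 1 \<Longrightarrow> s \<in> {a..b} \<Longrightarrow> t \<in> {a..b} \<Longrightarrow> \<bar>s - t\<bar> < d \<Longrightarrow> \<bar>F x s - F x t\<bar> < e / 2"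
    using uniform_in_space[OF F, of "e / 2"] e by (metis compact_Icc compact_sphere half_gt_zero)
  have "dist (sphere_mean (\<lambda>x. F x s)) (sphere_mean (\<lambda>x. F x t)) < e"
    if s: "s \<in> {a..b}" "dist s t < d" for s
  proof -
    note c = continuous_on_slice[OF F s(1)] continuous_on_slice[OF F t]
    have "\<bar>sphere_mean (\<lambda>x. F x s - F x t)\<bar> \<le> e / 2"
      using d(2)[OF _ s(1) t] s(2)
      by (intro sphere_mean_abs_le continuous_on_diff c) (auto simp: dist_real_def less_imp_le)
    then show ?thesis
      using e by (simp add: sphere_mean_diff[OF c] dist_real_def)
  qed
  then show "\<exists>d>0. \<forall>s\<in>{a..b}. dist s t < d \<longrightarrow>
      dist (sphere_mean (\<lambda>x. F x s)) (sphere_mean (\<lambda>x. F x t)) < e"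
    using d(1) by blast
qed

text \<open>Uniform continuity of \<open>F'\<close> on a compact set makes the error of the linear
  approximation uniform in \<open>x\<close>, so that it survives averaging.\<close>

lemma has_real_derivative_sphere_mean:
  fixes F F' :: "real^'n \<Rightarrow> real \<Rightarrow> real"
  assumes F: "\<And>t. t \<in> {a..b} \<Longrightarrow> continuous_on (sphere 0 1) (\<lambda>x. F x t)"
    and F': "continuous_on (sphere 0 1 \<times> {a..b}) (\<lambda>(x, t). F' x t)"
    and D: "\<And>x t. norm x = 1 \<Longrightarrow> t \<in> {a..b} \<Longrightarrow> ((\<lambda>s. F x s) has_real_derivative F' x t) (at t within {a..b})"
    and t: "t \<in> {a..b}"
  shows "((\<lambda>t. sphere_mean (\<lambda>x. F x t)) has_real_derivative sphere_mean (\<lambda>x. F' x t)) (at t within {a..b})"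
  unfolding has_field_derivative_def has_derivative_within_alt
proof (intro conjI allI impI)
  fix e :: real assume e: "e > 0"
  obtain d where d: "d > 0" "\<And>x s t. x \<in> sphere 0 1 \<Longrightarrow> s \<in> {a..b} \<Longrightarrow> t \<in> {a..b} \<Longrightarrow> \<bar>s - t\<bar> < d \<Longrightarrow> \<bar>F' x s - F' x t\<bar> < e"
    using uniform_in_space[OF F' _ _ e] by (metis compact_Icc compact_sphere)
  have "norm (sphere_mean (\<lambda>x. F x s) - sphere_mean (\<lambda>x. F x t) - sphere_mean (\<lambda>x. F' x t) * (s - t))
      \<le> e * norm (s - t)"
    if s: "s \<in> {a..b}" "norm (s - t) < d" for s
  proof -
    have c: "continuous_on (sphere 0 1) (\<lambda>x. F x s)" "continuous_on (sphere 0 1) (\<lambda>x. F x t)"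
      "continuous_on (sphere 0 1) (\<lambda>x. F' x t)"
      using F s(1) t continuous_on_slice[OF F' t] by auto
    have "\<bar>(F x s - F x t) - (s - t) * F' x t\<bar> \<le> e * \<bar>s - t\<bar>" if x: "norm x = 1" for x
    proof -
      let ?S = "{a..b} \<inter> ball t d"
      \<comment> \<open>Subtracting the linear function of slope \<open>F' x t\<close> leaves the
        derivative \<open>F' x r - F' x t\<close>, which is at most \<open>e\<close> in size on
        \<open>?S\<close>; the mean value inequality applies.\<close>
      have "norm ((F x s - F' x t * s) - (F x t - F' x t * t)) \<le> e * norm (s - t)"
      proof (rule field_differentiable_bound[where S = ?S])
        fix r assume r: "r \<in> ?S"
        have "((\<lambda>s. F x s) has_field_derivative F' x r) (at r within ?S)"
          using D[OF x] r by (auto intro: DERIV_subset)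
        then show "((\<lambda>s. F x s - F' x t * s) has_field_derivative F' x r - F' x t) (at r within ?S)"
          by (auto intro!: derivative_eq_intros)
        show "norm (F' x r - F' x t) \<le> e"
          using d(2)[of x r t] x r t by (auto simp: dist_real_def less_imp_le abs_minus_commute)
      qed (use s t d in \<open>auto simp: dist_real_def abs_minus_commute intro!: convex_Int\<close>)
      then show ?thesis by (simp add: algebra_simps)
    qed
    then have "\<bar>sphere_mean (\<lambda>x. (F x s - F x t) - (s - t) * F' x t)\<bar> \<le> e * \<bar>s - t\<bar>"
      by (intro sphere_mean_abs_le continuous_intros c) auto
    also have "sphere_mean (\<lambda>x. (F x s - F x t) - (s - t) * F' x t)
        = sphere_mean (\<lambda>x. F x s) - sphere_mean (\<lambda>x. F x t) - (s - t) * sphere_mean (\<lambda>x. F' x t)"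
      using c by (simp add: sphere_mean_diff sphere_mean_cmult continuous_on_diff continuous_on_mult_left)
    finally show ?thesis by (simp add: mult.commute)
  qed
  then show "\<exists>d>0. \<forall>s\<in>{a..b}. norm (s - t) < d \<longrightarrow>
      norm (sphere_mean (\<lambda>x. F x s) - sphere_mean (\<lambda>x. F x t) - sphere_mean (\<lambda>x. F' x t) * (s - t))
      \<le> e * norm (s - t)"
    using d(1) by blast
qed (rule bounded_linear_mult_right)

section \<open>The two entropies at a fixed time\<close>

locale volume_normalized_flow = gauss_flow u \<Omega> I
  for u :: "real^'n \<Rightarrow> real \<Rightarrow> real" and \<Omega> :: "real \<Rightarrow> (real^'n) set" and I :: "real set" +
  assumes zero: "0 \<in> I"
    and volume: "measure lebesgue (\<Omega> 0) = measure lebesgue (cball (0::real^'n) 1)"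
begin

lemma volume_eq: "t \<in> I \<Longrightarrow> measure lborel (\<Omega> t) = measure lborel (cball (0::real^'n) 1)"
proof (rule volume_preserved[OF zero])
  have "compact (\<Omega> 0)" using body[OF zero] by (simp add: convex_body_def)
  then show "measure lborel (\<Omega> 0) = measure lborel (cball (0::real^'n) 1)"
    using volume by (simp add: borel_compact)
qed

lemma continuous_on_u_slice: "t \<in> I \<Longrightarrow> continuous_on (sphere 0 1) (\<lambda>x. u x t)"
  and continuous_on_K_slice: "t \<in> I \<Longrightarrow> continuous_on (sphere 0 1) (\<lambda>x. K x t)"
  using continuous_on_slice[OF continuous_on_family] continuous_on_slice[OF continuous_on_K] by auto

lemma support_pos: "t \<in> I \<Longrightarrow> z \<in> interior (\<Omega> t) \<Longrightarrow> norm x = 1 \<Longrightarrow> u x t - x \<bullet> z > 0"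
  using smooth_body.interior_iff[OF slice_body] by simp

definition log_mean :: "real \<Rightarrow> real^'n \<Rightarrow> real" where
  "log_mean t z = sphere_mean (\<lambda>x. ln (u x t - x \<bullet> z))"

text \<open>By \<open>interior_iff\<close>, the support function about a point of the body is
  positive in all directions exactly when the point is interior.\<close>

lemma entropy_eq: "t \<in> I \<Longrightarrow> entropy (\<Omega> t) = (SUP z\<in>interior (\<Omega> t). log_mean t z)"
proof -
  assume t: "t \<in> I"
  interpret B: smooth_body "\<Omega> t" "\<lambda>y. u y t" by (rule slice_body[OF t])
  have s: "support_fun (\<Omega> t) z x = u x t - x \<bullet> z" if "norm x = 1" for x z
    using support_fun_shift[OF B.compact B.nonempty, of z x] supp[OF t, of x] that by simp
  have "{z\<in>\<Omega> t. \<forall>x\<in>sphere 0 1. support_fun (\<Omega> t) z x > 0} = interior (\<Omega> t)"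
    using interior_subset[of "\<Omega> t"] B.interior_iff s by auto
  moreover have "sphere_mean (\<lambda>x. ln (support_fun (\<Omega> t) z x)) = log_mean t z" for z
    unfolding log_mean_def using s by (intro sphere_mean_cong) simp
  ultimately show ?thesis by (simp add: entropy_def)
qed

lemma curvature_entropy_eq: "t \<in> I \<Longrightarrow> curvature_entropy (\<Omega> t) = sphere_mean (\<lambda>x. ln (K x t))"
proof -
  assume t: "t \<in> I"
  interpret B: smooth_body "\<Omega> t" "\<lambda>y. u y t" by (rule slice_body[OF t])
  show ?thesis
    unfolding curvature_entropy_def
    by (intro sphere_mean_cong) (simp add: B.inv_gauss_map B.gauss_curvature_touch K_def)
qed

lemma sphere_mean_ratio:
  assumes t: "t \<in> I" and z: "z \<in> interior (\<Omega> t)"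
  shows "sphere_mean (\<lambda>x. (u x t - x \<bullet> z) / K x t) = 1"
proof -
  interpret B: smooth_body "\<Omega> t" "\<lambda>y. u y t" by (rule slice_body[OF t])
  have "measure lborel (\<Omega> t) = (LINT y:cball 0 1 - {0}|lborel. (u (sgn y) t - sgn y \<bullet> z) / K (sgn y) t)"
    using K_pos[OF _ t] by (intro B.measure_eq_cone_integral[OF z continuous_on_K_slice[OF t]]) (auto simp: K_def)
  moreover have "continuous_on (sphere 0 1) (\<lambda>x. (u x t - x \<bullet> z) / K x t)"
    using K_pos[OF _ t] by (intro continuous_intros continuous_on_K_slice continuous_on_u_slice t) force
  ultimately show ?thesis
    using volume_eq[OF t] content_unit_cball_pos[where 'n = 'n] by (simp add: sphere_mean_eq)
qed

lemma continuous_on_ln_support: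
  assumes t: "t \<in> I" and z: "z \<in> interior (\<Omega> t)"
  shows "continuous_on (sphere 0 1) (\<lambda>x. ln (u x t - x \<bullet> z))"
  using support_pos[OF t z] by (intro continuous_intros continuous_on_u_slice t) force

lemma continuous_on_ln_K: "t \<in> I \<Longrightarrow> continuous_on (sphere 0 1) (\<lambda>x. ln (K x t))"
  using K_pos by (intro continuous_intros continuous_on_K_slice) force+

text \<open>Jensen's inequality in tangent line form: \<open>ln r \<le> r - 1\<close> for the ratio
  \<open>r\<close> of \<open>u x t - x \<bullet> z\<close> and \<open>K x t\<close>, whose mean is
  1.\<close>

lemma log_mean_le_curvature_entropy:
  assumes t: "t \<in> I" and z: "z \<in> interior (\<Omega> t)"
  shows "log_mean t z \<le> curvature_entropy (\<Omega> t)"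
proof -
  let ?v = "\<lambda>x. u x t - x \<bullet> z"
  have c: "continuous_on (sphere 0 1) (\<lambda>x. ?v x / K x t)"
    using K_pos[OF _ t] by (intro continuous_intros continuous_on_K_slice continuous_on_u_slice t) force
  have "log_mean t z - curvature_entropy (\<Omega> t) = sphere_mean (\<lambda>x. ln (?v x) - ln (K x t))"
    using sphere_mean_diff[OF continuous_on_ln_support[OF t z] continuous_on_ln_K[OF t]]
    by (simp add: log_mean_def curvature_entropy_eq[OF t])
  also have "\<dots> \<le> sphere_mean (\<lambda>x. ?v x / K x t - 1)"
  proof (rule sphere_mean_mono)
    show "ln (?v x) - ln (K x t) \<le> ?v x / K x t - 1" if x: "norm x = 1" for x
      using ln_le_minus_one[of "?v x / K x t"] support_pos[OF t z x] K_pos[OF x t]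
      by (simp add: ln_div)
  qed (intro continuous_on_diff continuous_on_ln_support[OF t z] continuous_on_ln_K[OF t] c continuous_on_const)+
  also have "\<dots> = 0"
    using sphere_mean_diff[OF c continuous_on_const[of _ 1]]
    by (simp add: sphere_mean_ratio[OF t z] sphere_mean_const)
  finally show ?thesis by simp
qed

text \<open>The curvature entropy is an upper bound common to all \<open>z\<close>, so the real
  supremum defining the entropy dominates its members.\<close>

lemma log_mean_le_entropy: "t \<in> I \<Longrightarrow> z \<in> interior (\<Omega> t) \<Longrightarrow> log_mean t z \<le> entropy (\<Omega> t)"
  unfolding entropy_eq
  by (rule cSUP_upper) (auto intro!: bdd_aboveI2 log_mean_le_curvature_entropy)

lemma entropy_leI:
  assumes t: "t \<in> I" and le: "\<And>z. z \<in> interior (\<Omega> t) \<Longrightarrow> log_mean t z \<le> c"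
  shows "entropy (\<Omega> t) \<le> c"
  unfolding entropy_eq[OF t]
  using smooth_body.interior_ne[OF slice_body[OF t]] le by (intro cSUP_least) auto

lemma entropy_le_curvature_entropy: "t \<in> I \<Longrightarrow> entropy (\<Omega> t) \<le> curvature_entropy (\<Omega> t)"
  by (intro entropy_leI log_mean_le_curvature_entropy)

section \<open>Growth of the mean logarithm along a transported point\<close>

context
  fixes a b z0 assumes ab: "a \<in> I" "b \<in> I" "a \<le> b" and z0: "z0 \<in> interior (\<Omega> b)"
begin

text \<open>Translations of a solution by \<open>exp (t - b) *\<^sub>R z0\<close> are solutions, and \<open>exp (- t)\<close> times a
  solution decreases, so that a point that is interior at time \<open>b\<close> is carried to interior points at
  earlier times.\<close>

lemma transported_interior:
  assumes t: "t \<in> {a..b}"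
  shows "exp (t - b) *\<^sub>R z0 \<in> interior (\<Omega> t)"
proof -
  have tI: "t \<in> I" using t Icc_subset ab by blast
  have "x \<bullet> exp (t - b) *\<^sub>R z0 < u x t" if x: "norm x = 1" for x
  proof -
    have "x \<bullet> z0 < u x b"
      using support_pos[OF ab(2) z0 x] by simp
    then have "exp (- b) * (x \<bullet> z0) < w x b" by (simp add: w_def)
    also have "\<dots> \<le> w x t"
      using w_decreasing[OF x tI ab(2)] t by (cases "t = b") auto
    finally have "exp t * (exp (- b) * (x \<bullet> z0)) < exp t * w x t" by simp
    then show ?thesis
      by (simp add: w_def exp_diff exp_minus field_simps)
  qed
  then show ?thesis
    using smooth_body.interior_iff[OF slice_body[OF tI]] by blast
qed

text \<open>The rate \<open>\<phi>'\<close> is the mean of \<open>1 - K x t / ?v x t\<close>, the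
  exact time derivative of the mean of \<open>ln (?v x t)\<close>. The fundamental theorem of
  calculus is applied to this rate; the entropies enter only through a pointwise bound, so no
  regularity of the entropy in time is assumed here.\<close>

lemma log_mean_growth:
  "\<exists>\<phi>'. (\<phi>' has_integral log_mean b z0 - log_mean a (exp (a - b) *\<^sub>R z0)) {a..b} \<and>
    (\<forall>t\<in>{a..b}. \<phi>' t \<le> entropy (\<Omega> t) - curvature_entropy (\<Omega> t))"
proof -
  let ?z = "\<lambda>t. exp (t - b) *\<^sub>R z0"
  let ?v = "\<lambda>x t. u x t - x \<bullet> ?z t"
  let ?\<phi>' = "\<lambda>t. sphere_mean (\<lambda>x. 1 - K x t / ?v x t)"
  have sub: "{a..b} \<subseteq> I" using Icc_subset ab by blast
  have pos: "?v x t > 0" if "norm x = 1" "t \<in> {a..b}" for x t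
    using support_pos[OF _ transported_interior[OF that(2)] that(1)] sub that by blast
  have cont: "continuous_on (sphere 0 1 \<times> {a..b}) (\<lambda>(x, t). 1 - K x t / ?v x t)"
  proof -
    have 1: "continuous_on (sphere 0 1 \<times> {a..b}) (\<lambda>p. K (fst p) (snd p))"
      "continuous_on (sphere 0 1 \<times> {a..b}) (\<lambda>p. u (fst p) (snd p))"
      using continuous_on_subset[OF continuous_on_K, of "sphere 0 1 \<times> {a..b}"]
        continuous_on_subset[OF continuous_on_family, of "sphere 0 1 \<times> {a..b}"] sub
      by (auto simp: case_prod_unfold)
    have "?v (fst p) (snd p) \<noteq> 0" if "p \<in> sphere 0 1 \<times> {a..b}" for p
      using pos[of "fst p" "snd p"] that by auto
    then show ?thesis
      unfolding case_prod_unfold by (intro continuous_intros 1) auto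
  qed
  have der: "((\<lambda>t. log_mean t (?z t)) has_real_derivative ?\<phi>' t) (at t within {a..b})" if t: "t \<in> {a..b}" for t
    unfolding log_mean_def
  proof (rule has_real_derivative_sphere_mean[OF _ cont _ t])
    show "continuous_on (sphere 0 1) (\<lambda>x. ln (?v x t))" if "t \<in> {a..b}" for t
      using sub that by (intro continuous_on_ln_support transported_interior) auto
    fix x :: "real^'n" and s assume x: "norm x = 1" and s: "s \<in> {a..b}"
    have "((\<lambda>s. u x s) has_real_derivative u x s - K x s) (at s within {a..b})"
      by (rule DERIV_subset[OF derivative_u[OF x]]) (use s sub in auto)
    then have "((\<lambda>s. ?v x s) has_real_derivative ?v x s - K x s) (at s within {a..b})"
      by (auto intro!: derivative_eq_intros)
    moreover have "((\<lambda>s. ln (f s)) has_real_derivative inverse (f s) * D) (at s within {a..b})"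
      if "(f has_real_derivative D) (at s within {a..b})" "f s > 0" for f :: "real \<Rightarrow> real" and D
      using that by (auto intro!: derivative_eq_intros simp: divide_inverse)
    ultimately have "((\<lambda>s. ln (?v x s)) has_real_derivative inverse (?v x s) * (?v x s - K x s)) (at s within {a..b})"
      using pos[OF x s] by blast
    moreover have "inverse (?v x s) * (?v x s - K x s) = 1 - K x s / ?v x s"
      using pos[OF x s] by (simp add: field_simps)
    ultimately show "((\<lambda>s. ln (?v x s)) has_real_derivative 1 - K x s / ?v x s) (at s within {a..b})"
      by simp
  qed
  have "(?\<phi>' has_integral log_mean b (?z b) - log_mean a (?z a)) {a..b}"
    using der by (intro fundamental_theorem_of_calculus ab)
      (simp add: has_real_derivative_iff_has_vector_derivative)
  then have "(?\<phi>' has_integral log_mean b z0 - log_mean a (exp (a - b) *\<^sub>R z0)) {a..b}"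
    by simp
  moreover have "?\<phi>' t \<le> entropy (\<Omega> t) - curvature_entropy (\<Omega> t)" if t: "t \<in> {a..b}" for t
  proof -
    have tI: "t \<in> I" using t sub by blast
    note z = transported_interior[OF t]
    have "?\<phi>' t \<le> sphere_mean (\<lambda>x. ln (?v x t) - ln (K x t))"
    proof (rule sphere_mean_mono)
      show "1 - K x t / ?v x t \<le> ln (?v x t) - ln (K x t)" if x: "norm x = 1" for x
        using ln_le_minus_one[of "K x t / ?v x t"] pos[OF x t] K_pos[OF x tI] by (simp add: ln_div)
    qed (rule continuous_on_slice[OF cont t],
        intro continuous_on_diff continuous_on_ln_support[OF tI z] continuous_on_ln_K[OF tI])
    also have "\<dots> = log_mean t (?z t) - curvature_entropy (\<Omega> t)"
      using sphere_mean_diff[OF continuous_on_ln_support[OF tI z] continuous_on_ln_K[OF tI]]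
      by (simp add: log_mean_def curvature_entropy_eq[OF tI])
    also have "\<dots> \<le> entropy (\<Omega> t) - curvature_entropy (\<Omega> t)"
      using log_mean_le_entropy[OF tI z] by simp
    finally show ?thesis .
  qed
  ultimately show ?thesis by blast
qed

end

text \<open>Bounding the rate by 0 instead of by the entropy difference needs no integral of the
  entropy, so monotonicity is available for proving that this integral exists.\<close>

lemma entropy_antimono:
  assumes ab: "a \<in> I" "b \<in> I" "a \<le> b"
  shows "entropy (\<Omega> b) \<le> entropy (\<Omega> a)"
proof (rule entropy_leI[OF ab(2)])
  fix z assume z: "z \<in> interior (\<Omega> b)"
  obtain \<phi>' where \<phi>': "(\<phi>' has_integral log_mean b z - log_mean a (exp (a - b) *\<^sub>R z)) {a..b}"
    "\<And>t. t \<in> {a..b} \<Longrightarrow> \<phi>' t \<le> entropy (\<Omega> t) - curvature_entropy (\<Omega> t)"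
    using log_mean_growth[OF ab z] by blast
  have "log_mean b z - log_mean a (exp (a - b) *\<^sub>R z) \<le> 0"
  proof (rule has_integral_le[OF \<phi>'(1) has_integral_0])
    fix t assume t: "t \<in> {a..b}"
    then have "t \<in> I" using Icc_subset ab by blast
    then show "\<phi>' t \<le> 0" using \<phi>'(2)[OF t] entropy_le_curvature_entropy by fastforce
  qed
  then show "log_mean b z \<le> entropy (\<Omega> a)"
    using log_mean_le_entropy[OF ab(1) transported_interior[OF ab z, of a]] ab by simp
qed

text \<open>The entropy is integrable because it is monotone, the curvature entropy because it is
  continuous in time.\<close>

lemma entropy_difference_integrable:
  assumes ab: "a \<in> I" "b \<in> I"
  shows "(\<lambda>t. entropy (\<Omega> t) - curvature_entropy (\<Omega> t)) integrable_on {a..b}"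
proof (rule integrable_diff)
  have sub: "{a..b} \<subseteq> I" using Icc_subset ab by blast
  have "mono_on {a..b} (\<lambda>t. - entropy (\<Omega> t))"
    using sub by (intro mono_onI) (auto intro!: entropy_antimono)
  from integrable_neg[OF integrable_on_mono_on[OF this]]
  show "(\<lambda>t. entropy (\<Omega> t)) integrable_on {a..b}" by simp
  have "continuous_on (sphere 0 1 \<times> {a..b}) (\<lambda>p. K (fst p) (snd p))"
    using continuous_on_subset[OF continuous_on_K, of "sphere 0 1 \<times> {a..b}"] sub
    by (auto simp: case_prod_unfold)
  then have "continuous_on (sphere 0 1 \<times> {a..b}) (\<lambda>(x, t). ln (K x t))"
    unfolding case_prod_unfold using K_pos sub by (intro continuous_on_ln) fastforce+
  from continuous_on_sphere_mean[OF this]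
  have "continuous_on {a..b} (\<lambda>t. curvature_entropy (\<Omega> t))"
    by (rule continuous_on_eq) (use sub in \<open>auto simp: curvature_entropy_eq\<close>)
  then show "(\<lambda>t. curvature_entropy (\<Omega> t)) integrable_on {a..b}"
    by (rule integrable_continuous_interval)
qed

text \<open>The bound \<open>?J\<close> does not involve \<open>z\<close>, so the estimate for one
  point interior at time \<open>b\<close> passes to the supremum; at time \<open>a\<close> the
  transported point is one competitor for the entropy.\<close>

lemma entropy_dissipation:
  assumes ab: "a \<in> I" "b \<in> I" "a \<le> b"
  shows "entropy (\<Omega> b) - entropy (\<Omega> a) \<le> integral {a..b} (\<lambda>t. entropy (\<Omega> t) - curvature_entropy (\<Omega> t))"
    (is "_ \<le> ?J")
proof -
  have "entropy (\<Omega> b) \<le> entropy (\<Omega> a) + ?J"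
  proof (rule entropy_leI[OF ab(2)])
    fix z assume z: "z \<in> interior (\<Omega> b)"
    obtain \<phi>' where \<phi>': "(\<phi>' has_integral log_mean b z - log_mean a (exp (a - b) *\<^sub>R z)) {a..b}"
      "\<And>t. t \<in> {a..b} \<Longrightarrow> \<phi>' t \<le> entropy (\<Omega> t) - curvature_entropy (\<Omega> t)"
      using log_mean_growth[OF ab z] by blast
    have "log_mean b z - log_mean a (exp (a - b) *\<^sub>R z) \<le> ?J"
      using has_integral_le[OF \<phi>'(1) integrable_integral[OF entropy_difference_integrable[OF ab(1,2)]]] \<phi>'(2)
      by blast
    then show "log_mean b z \<le> entropy (\<Omega> a) + ?J"
      using log_mean_le_entropy[OF ab(1) transported_interior[OF ab z, of a]] ab by simp
  qed
  then show ?thesis by simp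
qed

lemma entropy_dissipation_nonpos:
  assumes "a \<in> I" "b \<in> I"
  shows "integral {a..b} (\<lambda>t. entropy (\<Omega> t) - curvature_entropy (\<Omega> t)) \<le> 0"
proof (rule has_integral_le[OF integrable_integral[OF entropy_difference_integrable[OF assms]] has_integral_0])
  fix t assume "t \<in> {a..b}"
  then have "t \<in> I" using Icc_subset assms by blast
  then show "entropy (\<Omega> t) - curvature_entropy (\<Omega> t) \<le> 0"
    using entropy_le_curvature_entropy by simp
qed

end

theorem theorem3p9:
  fixes u :: "real^'n \<Rightarrow> real \<Rightarrow> real"
    and \<Omega> :: "real \<Rightarrow> (real^'n) set"
    and I :: "real set"
  assumes "is_interval I" and "0 \<in> I"
    and "normalized_gauss_flow I u"
    and "\<And>t. t \<in> I \<Longrightarrow> convex_body (\<Omega> t)"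
    and "\<And>t x. t \<in> I \<Longrightarrow> x \<in> sphere 0 1 \<Longrightarrow> u x t = support_fun (\<Omega> t) 0 x"
    and "measure lebesgue (\<Omega> 0) = measure lebesgue (cball (0::real^'n) 1)"
  shows "antimono_on I (\<lambda>t. entropy (\<Omega> t)) \<and>
    (\<forall>t1\<in>I. \<forall>t0\<in>I. t1 \<le> t0 \<longrightarrow>
       (\<lambda>t. entropy (\<Omega> t) - curvature_entropy (\<Omega> t)) integrable_on {t1..t0} \<and>
       entropy (\<Omega> t0) - entropy (\<Omega> t1)
         \<le> integral {t1..t0} (\<lambda>t. entropy (\<Omega> t) - curvature_entropy (\<Omega> t)) \<and>
       integral {t1..t0} (\<lambda>t. entropy (\<Omega> t) - curvature_entropy (\<Omega> t)) \<le> 0)"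
proof (cases "\<exists>a\<in>I. \<exists>b\<in>I. a < b")
  case True
  then interpret volume_normalized_flow u \<Omega> I
    using assms by unfold_locales auto
  show ?thesis
    using entropy_antimono entropy_difference_integrable entropy_dissipation entropy_dissipation_nonpos
    by (auto simp: monotone_on_def)
next
  \<comment> \<open>The interval is a single time: the two entropies are evaluated at the same body
    and the integral is over one point.\<close>
  case False
  then have single: "s = t" if "s \<in> I" "t \<in> I" for s t
    using that by (metis linorder_neqE_linordered_idom)
  show ?thesis
  proof (intro conjI ballI impI)
    show "antimono_on I (\<lambda>t. entropy (\<Omega> t))"
      using single by (auto simp: monotone_on_def)
    fix t1 t0 assume "t1 \<in> I" "t0 \<in> I"
    then have [simp]: "t0 = t1" by (rule single[symmetric])
    show "(\<lambda>t. entropy (\<Omega> t) - curvature_entropy (\<Omega> t)) integrable_on {t1..t0}"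
      "entropy (\<Omega> t0) - entropy (\<Omega> t1)
        \<le> integral {t1..t0} (\<lambda>t. entropy (\<Omega> t) - curvature_entropy (\<Omega> t))"
      "integral {t1..t0} (\<lambda>t. entropy (\<Omega> t) - curvature_entropy (\<Omega> t)) \<le> 0"
      using integrable_on_refl[of "\<lambda>t. entropy (\<Omega> t) - curvature_entropy (\<Omega> t)" t1] by simp_all
  qed
qed

end
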